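(* Let $(\mathbb{K},|\cdot|)$ be a complete normed field, $f\in\mathbb{K}[z]$ a polynomial of degree $n\ge 2$, $T\colon D\subset\mathbb{K}^n\to\mathbb{K}^n$ an iteration function, and $1\le p\le\infty$. Suppose there exists $\tau>0$ such that for every $x\in\mathcal{D}$ with $E_f(x)<\tau$: (a) $x\in D$; (b) $\|x-T(x)\|\preceq\gamma(E_f(x))\,\|W_f(x)\|$; (c) $\|W_f(T(x))\|\preceq\beta(E_f(x))\,\|W_f(x)\|$, where $\beta\colon[0,\tau)\to\mathbb{R}_+$ is quasi-homogeneous of degree $m\ge 0$ on $[0,\tau)$, and $\gamma$ is a nondecreasing positive function on $[0,\tau)$ such that the function $\psi(t)=1-b\,t\,\gamma(t)$ is positive on $[0,\tau)$. Put $\phi=\beta/\psi$ and $r=m+1$. Let $x^{(0)}\in\mathcal{D}$ satisfy $$E_f(x^{(0)})<\tau\quad\text{and}\quad\phi(E_f(x^{(0)}))\le 1 .$$ Then the following hold. (i) Starting from $x^{(0)}$, the iteration $x^{(k+1)}=T(x^{(k)})$, $k=0,1,2,\ldots$, is well-defined, remains in the closed ball $\overline{U}(x^{(0)},\rho)$ and converges to a root vector $\xi$ of $f$, where $\rho=\frac{\gamma(E_f(x^{(0)}))}{1-\beta(E_f(x^{(0)}))}\,\|W_f(x^{(0)})\|$. Besides, the convergence is of order $r=m+1$ provided that $\phi(E_f(x^{(0)}))<1$. (ii) For all $k\ge 0$, $$\|x^{(k)}-\xi\|\preceq A_k\,\frac{\theta^k\lambda^{S_k(r)}}{1-\theta\lambda^{r^k}}\,\|W_f(x^{(0)})\|,$$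 where $\lambda=\phi(E_f(x^{(0)}))$, $\theta=\psi(E_f(x^{(0)}))$ and $A_k=\gamma\big(E_f(x^{(0)})\,\lambda^{S_k(r)}\big)$. (iii) For all $k\ge 0$, $$\|x^{(k)}-\xi\|\preceq\frac{\gamma(E_f(x^{(k)}))}{1-\beta(E_f(x^{(k)}))}\,\|W_f(x^{(k)})\|.$$ (iv) For all $k\ge 0$, $$\|x^{(k+1)}-\xi\|\preceq\frac{\theta_k\lambda_k}{1-\theta_k(\lambda_k)^r}\,\gamma(E_f(x^{(k+1)}))\,\|W_f(x^{(k)})\|,$$ where $\lambda_k=\phi(E_f(x^{(k)}))$ and $\theta_k=\psi(E_f(x^{(k)}))$. (v) For all $k\ge 0$, $\|W_f(x^{(k+1)})\|\preceq\theta\,\lambda^{r^k}\,\|W_f(x^{(k)})\|$ and $\|W_f(x^{(k)})\|\preceq\theta^k\lambda^{S_k(r)}\,\|W_f(x^{(0)})\|$. (vi) If $\phi(E_f(x^{(0)}))<1$, then $f$ has $n$ simple zeros in $\mathbb{K}$ and for every $k\ge 0$ the closed disks $D_i^k=\{z\in\mathbb{K}:|z-x_i^{(k)}|\le r_i^{(k)}\}$, $i=1,\ldots,n$, where $r_i^{(k)}=\frac{\gamma(E_f(x^{(k)}))}{1-\beta(E_f(x^{(k)}))}\,|W_i(x^{(k)})|$, are mutually disjoint and each of them contains exactly one zero of $f$.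
   Context: A complete normed field $(\mathbb{K},|\cdot|)$ is a field with an absolute value (multiplicative, satisfying the triangle inequality) which is complete as a metric space. $\mathbb{R}_+=[0,\infty)$. For $1\le p\le\infty$, $\|x\|_p=(\sum_i|x_i|^p)^{1/p}$ (maximum norm if $p=\infty$); $q$ is the conjugate exponent, $1\le q\le\infty$, $1/p+1/q=1$ (with $1/\infty=0$), and $b=2^{1/q}$. For $x\in\mathbb{K}^n$ the cone norm is $\|x\|=(|x_1|,\ldots,|x_n|)\in\mathbb{R}^n$; $\preceq$ is the coordinatewise order $\le$ on $\mathbb{R}^n$. For $x\in\mathbb{K}^n$ and $y\in\mathbb{R}^n$ with no zero components, $\frac{x}{y}=\big(\frac{|x_1|}{y_1},\ldots,\frac{|x_n|}{y_n}\big)$. Let $d(x)=(d_1(x),\ldots,d_n(x))$ with $d_i(x)=\min_{j\ne i}|x_i-x_j|$. $\mathcal{D}$ is the set of vectors in $\mathbb{K}^n$ with pairwise distinct components. If $C_0$ is the leading coefficient of $f$, the Weierstrass correction $W_f\colon\mathcal{D}\to\mathbb{K}^n$ is $W_f(x)=(W_1(x),\ldots,W_n(x))$ with $W_i(x)=\frac{f(x_i)}{C_0\prod_{j\ne i}(x_i-x_j)}$, and $E_f\colon\mathcal{D}\to\mathbb{R}_+$ is $E_f(x)=\big\|\frac{W_f(x)}{d(x)}\big\|_p$. A vector $\xi\in\mathbb{K}^n$ is a root vector of $f$ if $f(z)=C_0\prod_{i=1}^n(z-\xi_i)$. For $\rho\in\mathbb{R}_+^n$, $\overline{U}(x^{(0)},\rho)=\{x\in\mathbb{K}^n:\|x-x^{(0)}\|\preceq\rho\}$.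 A function $\beta\colon J\to\mathbb{R}_+$ on an interval $J\subset\mathbb{R}_+$ containing $0$ is quasi-homogeneous of degree $m\ge 0$ if $\beta(st)\le s^m\beta(t)$ for all $s\in[0,1]$ and $t\in J$. $S_k(t)=1+t+\cdots+t^{k-1}$ for $k\ge 1$ and $S_0(t)\equiv 0$. Convention: $0^0=1$. In (b), (c) the assumptions (b) and $\psi>0$ ensure that $T(x)\in\mathcal{D}$, so $W_f(T(x))$ is defined. "Convergence of order $r$" means order at least $r$ in the following sense: there are $C>0$ and $\eta\in(0,1)$ such that, for all $k\ge0$, $\|x^{(k)}-\xi\|_\infty\le C\eta^{r^k}$ if $r>1$, and $\|x^{(k)}-\xi\|_\infty\le C\eta^{k}$ if $r=1$. *)

theory Defs
  imports "HOL-Analysis.Analysis" "HOL-Computational_Algebra.Polynomial"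
begin

text \<open>The absolute value is an explicit parameter, because the library classes for
  normed fields are real algebras and would exclude, for instance, p-adic fields.\<close>

definition absolute_value :: "('a::field \<Rightarrow> real) \<Rightarrow> bool" where
  "absolute_value av \<longleftrightarrow>
     (\<forall>a. 0 \<le> av a) \<and> (\<forall>a. av a = 0 \<longleftrightarrow> a = 0) \<and>
     (\<forall>a b. av (a * b) = av a * av b) \<and> (\<forall>a b. av (a + b) \<le> av a + av b)"

definition complete_normed_field :: "('a::field \<Rightarrow> real) \<Rightarrow> bool" where
  "complete_normed_field av \<longleftrightarrow>
     absolute_value av \<and> Metric_space.mcomplete UNIV (\<lambda>a b. av (a - b))"

lemma absolute_value_one:
  assumes "absolute_value av"
  shows "av 1 = 1"
proof -
  have "av 1 * av 1 = av 1 * 1" "av 1 \<noteq> 0"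
    using assms unfolding absolute_value_def
    by (metis mult_1_right, metis one_neq_zero)
  then show ?thesis by simp
qed

lemma absolute_value_minus:
  assumes "absolute_value av"
  shows "av (- a) = av a"
proof -
  have mult: "\<And>a b. av (a * b) = av a * av b" and nonneg: "\<And>a. 0 \<le> av a"
    using assms unfolding absolute_value_def by auto
  have "(av (- 1))\<^sup>2 = 1"
    using mult[of "- 1" "- 1"] absolute_value_one[OF assms] by (simp add: power2_eq_square)
  then have "av (- 1) = 1"
    using nonneg[of "- 1"] by (simp add: power2_eq_1_iff)
  then show ?thesis
    using mult[of "- 1" a] by simp
qed

lemma absolute_value_Metric_space:
  assumes "absolute_value av"
  shows "Metric_space UNIV (\<lambda>a b. av (a - b))"
proof
  fix a b c
  show "0 \<le> av (a - b)" "(av (a - b) = 0) = (a = b)"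
    using assms unfolding absolute_value_def by auto
  show "av (a - b) = av (b - a)"
    using absolute_value_minus[OF assms, of "a - b"] by simp
  have "av ((a - b) + (b - c)) \<le> av (a - b) + av (b - c)"
    using assms unfolding absolute_value_def by blast
  then show "av (a - c) \<le> av (a - b) + av (b - c)" by simp
qed

text \<open>Cone norm with values in \<open>real ^ 'n\<close>, whose library order \<open>\<le>\<close> is the coordinatewise one.\<close>

definition cone_norm :: "('a \<Rightarrow> real) \<Rightarrow> 'a ^ 'n \<Rightarrow> real ^ 'n" where
  "cone_norm av x = (\<chi> i. av (x $ i))"

definition cone_quot :: "('a \<Rightarrow> real) \<Rightarrow> 'a ^ 'n \<Rightarrow> real ^ 'n \<Rightarrow> real ^ 'n" where
  "cone_quot av x y = (\<chi> i. av (x $ i) / y $ i)"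

definition p_norm :: "ereal \<Rightarrow> real ^ 'n \<Rightarrow> real" where
  "p_norm p x =
     (if p = \<infinity> then Max (range (\<lambda>i. \<bar>x $ i\<bar>))
      else (\<Sum>i\<in>UNIV. \<bar>x $ i\<bar> powr real_of_ereal p) powr (1 / real_of_ereal p))"

definition distinct_vecs :: "('a ^ 'n) set" where
  "distinct_vecs = {x. \<forall>i j. i \<noteq> j \<longrightarrow> x $ i \<noteq> x $ j}"

text \<open>Meaningful only for \<open>CARD('n) \<ge> 2\<close>.\<close>

definition sep_vec :: "('a::field \<Rightarrow> real) \<Rightarrow> 'a ^ 'n \<Rightarrow> real ^ 'n" where
  "sep_vec av x = (\<chi> i. Min ((\<lambda>j. av (x $ i - x $ j)) ` (UNIV - {i})))"

definition weierstrass :: "'a::field poly \<Rightarrow> 'a ^ 'n \<Rightarrow> 'a ^ 'n" where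
  "weierstrass f x =
     (\<chi> i. poly f (x $ i) / (lead_coeff f * (\<Prod>j\<in>UNIV - {i}. x $ i - x $ j)))"

definition Ef :: "('a::field \<Rightarrow> real) \<Rightarrow> ereal \<Rightarrow> 'a poly \<Rightarrow> 'a ^ 'n \<Rightarrow> real" where
  "Ef av p f x = p_norm p (cone_quot av (weierstrass f x) (sep_vec av x))"

text \<open>The identity \<open>f(z) = C\<^sub>0 \<Prod> (z - \<xi>\<^sub>i)\<close> is one of polynomials, which matters over finite fields.\<close>

definition root_vector :: "'a::field poly \<Rightarrow> 'a ^ 'n \<Rightarrow> bool" where
  "root_vector f \<xi> \<longleftrightarrow> f = smult (lead_coeff f) (\<Prod>i\<in>UNIV. [:- (\<xi> $ i), 1:])"

definition closed_cone_ball :: "('a::field \<Rightarrow> real) \<Rightarrow> 'a ^ 'n \<Rightarrow> real ^ 'n \<Rightarrow> ('a ^ 'n) set" where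
  "closed_cone_ball av x0 \<rho> = {x. cone_norm av (x - x0) \<le> \<rho>}"

definition closed_disk :: "('a::field \<Rightarrow> real) \<Rightarrow> 'a \<Rightarrow> real \<Rightarrow> 'a set" where
  "closed_disk av c r = {z. av (z - c) \<le> r}"

text \<open>Real powers of nonnegative numbers with \<open>0\<^sup>0 = 1\<close>, whereas \<open>0 powr 0 = 0\<close>.\<close>

definition rpow :: "real \<Rightarrow> real \<Rightarrow> real" where
  "rpow s a = (if s = 0 \<and> a = 0 then 1 else s powr a)"

definition quasi_homogeneous_on :: "real set \<Rightarrow> real \<Rightarrow> (real \<Rightarrow> real) \<Rightarrow> bool" where
  "quasi_homogeneous_on J m \<beta> \<longleftrightarrow>
     (\<forall>t\<in>J. 0 \<le> \<beta> t) \<and> (\<forall>s\<in>{0..1}. \<forall>t\<in>J. \<beta> (s * t) \<le> rpow s m * \<beta> t)"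

definition geom_sum :: "nat \<Rightarrow> real \<Rightarrow> real" where
  "geom_sum k t = (\<Sum>j<k. t ^ j)"

definition cone_converges ::
  "('a::field \<Rightarrow> real) \<Rightarrow> (nat \<Rightarrow> 'a ^ 'n) \<Rightarrow> 'a ^ 'n \<Rightarrow> bool" where
  "cone_converges av x \<xi> \<longleftrightarrow> (\<lambda>k. cone_norm av (x k - \<xi>)) \<longlonglongrightarrow> 0"

definition convergence_of_order ::
  "('a::field \<Rightarrow> real) \<Rightarrow> real \<Rightarrow> (nat \<Rightarrow> 'a ^ 'n) \<Rightarrow> 'a ^ 'n \<Rightarrow> bool" where
  "convergence_of_order av r x \<xi> \<longleftrightarrow>
     (\<exists>C>0. \<exists>\<eta>\<in>{0<..<1}. \<forall>k.
        (r > 1 \<longrightarrow> p_norm \<infinity> (cone_norm av (x k - \<xi>)) \<le> C * \<eta> powr (r ^ k)) \<and>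
        (r = 1 \<longrightarrow> p_norm \<infinity> (cone_norm av (x k - \<xi>)) \<le> C * \<eta> ^ k))"

end

theory Submission
  imports Defs
begin

text \<open>A step from \<open>y\<close> moves the \<open>i\<close>-th component by at most \<open>\<gamma>(E y) |W\<^sub>i(y)|\<close>. By Hoelder's
  inequality for two coordinates, \<open>|W\<^sub>i(y)| + |W\<^sub>j(y)| \<le> b E(y) |y\<^sub>i - y\<^sub>j|\<close>, so distances between
  components shrink at most by the factor \<open>\<psi>(E y)\<close> and therefore \<open>E(T y) \<le> \<phi>(E y) E(y)\<close>.
  Quasi-homogeneity turns this into \<open>E(x\<^sub>k) \<le> E(x\<^sub>0) \<lambda>^S\<^sub>k(r)\<close> and \<open>\<beta>(E(x\<^sub>k)) \<le> \<theta> \<lambda>^(r^k)\<close>, and the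
  corrections decay geometrically. The steps are thus summable; letting \<open>k \<rightarrow> \<infinity>\<close> coefficientwise in
  the Lagrange interpolation of \<open>f\<close> at \<open>x\<^sub>k\<close> shows that the limit is a root vector. All error bounds
  come from restarting the iteration at \<open>x\<^sub>k\<close>. If \<open>\<phi> < 1\<close>, then \<open>\<gamma> b E = 1 - \<psi> < 1 - \<beta>\<close>, which is
  exactly what separates the disks.\<close>

section \<open>Real powers and \<open>p\<close>-norms\<close>

lemma rpow_ge_0: "0 \<le> rpow s a"
  by (simp add: rpow_def)

lemma rpow_0_right [simp]: "rpow s 0 = 1"
  by (simp add: rpow_def)

lemma rpow_one_right: "0 \<le> s \<Longrightarrow> rpow s 1 = s"
  by (simp add: rpow_def)

text \<open>At base 0 the sign condition matters: \<open>rpow 0 0 = 1\<close>, while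
  \<open>rpow 0 1 * rpow 0 (- 1) = 0\<close>.\<close>

lemma rpow_add:
  assumes "0 \<le> a" "0 \<le> b"
  shows "rpow s (a + b) = rpow s a * rpow s b"
  using assms by (auto simp: rpow_def powr_add)

lemma rpow_rpow:
  assumes "0 \<le> a" "0 \<le> b"
  shows "rpow (rpow s a) b = rpow s (a * b)"
  using assms by (auto simp: rpow_def powr_powr)

lemma rpow_le_1:
  assumes "0 \<le> s" "s \<le> 1" "0 \<le> a"
  shows "rpow s a \<le> 1"
  using assms powr_mono2[of a s 1] by (auto simp: rpow_def)

lemma rpow_mono_base:
  assumes "0 \<le> s" "s \<le> t" "0 \<le> a"
  shows "rpow s a \<le> rpow t a"
  using assms powr_mono2[of a s t] by (auto simp: rpow_def)

lemma geom_sum_Suc: "geom_sum (Suc k) r = geom_sum k r + r ^ k"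
  by (simp add: geom_sum_def)

lemma geom_sum_nonneg: "0 \<le> r \<Longrightarrow> 0 \<le> geom_sum k r"
  by (simp add: geom_sum_def sum_nonneg)

text \<open>The undivided form also covers \<open>r = 1\<close>. For \<open>r = m + 1\<close> it
  gives \<open>m * geom_sum k r + 1 = r ^ k\<close>, the identity behind the exponents
  below.\<close>

lemma geom_sum_times: "(r - 1) * geom_sum k r = r ^ k - 1"
  unfolding geom_sum_def by (rule power_diff_1_eq [symmetric])

text \<open>Write \<open>s\<close> as \<open>s / t * t\<close>; the factor
  \<open>rpow (s / t) m\<close> is at most 1.\<close>

lemma quasi_homogeneous_on_mono:
  assumes "quasi_homogeneous_on {0..<\<tau>} m \<beta>" "0 \<le> m" "0 \<le> s" "s \<le> t" "t < \<tau>"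
  shows "\<beta> s \<le> \<beta> t"
proof (cases "t = 0")
  case False
  have "s / t \<in> {0..1}" "t \<in> {0..<\<tau>}"
    using assms False by (auto simp: divide_simps)
  then have "\<beta> (s / t * t) \<le> rpow (s / t) m * \<beta> t"
    using assms(1) unfolding quasi_homogeneous_on_def by blast
  also have "\<dots> \<le> 1 * \<beta> t"
  proof (rule mult_right_mono)
    show "rpow (s / t) m \<le> 1"
      using assms by (intro rpow_le_1) (auto simp: divide_simps)
    show "0 \<le> \<beta> t"
      using assms unfolding quasi_homogeneous_on_def by auto
  qed
  finally show ?thesis using False by simp
qed (use assms in auto)

text \<open>Midpoint convexity of the \<open>P\<close>-th power, applied at positive arguments; if
  one of the numbers is 0, the constant being at least 1 is enough.\<close>

lemma powr_sum_bound:
  fixes s t P :: real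
  assumes "1 \<le> P" "0 \<le> s" "0 \<le> t"
  shows "s + t \<le> 2 powr (1 - 1 / P) * (s powr P + t powr P) powr (1 / P)"
proof -
  have *: "1 \<le> 2 powr (1 - 1 / P)"
    using assms by (intro ge_one_powr_ge_zero) auto
  have **: "u \<le> 2 powr (1 - 1 / P) * (u powr P) powr (1 / P)" if "0 \<le> u" for u
    using that assms mult_right_mono[OF *, of u] by (simp add: powr_powr)
  show ?thesis
  proof (cases "s = 0 \<or> t = 0")
    case True
    then show ?thesis using **[of s] **[of t] assms by auto
  next
    case False
    then have pos: "0 < s" "0 < t" using assms by auto
    have "(s / 2 + t / 2) powr P \<le> s powr P / 2 + t powr P / 2"
      using convex_onD[OF powr_convex[OF assms(1)], of "1/2" s t] pos by simp
    then have "((s + t) / 2) powr P \<le> (s powr P + t powr P) / 2"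
      by (simp add: add_divide_distrib)
    then have "(((s + t) / 2) powr P) powr (1 / P) \<le> ((s powr P + t powr P) / 2) powr (1 / P)"
      using assms by (intro powr_mono2) auto
    \<comment> \<open>Clearing both denominators leaves \<open>2 / 2 powr (1 / P)\<close>, which is
      the stated constant.\<close>
    then have "(s + t) / 2 \<le> (s powr P + t powr P) powr (1 / P) / 2 powr (1 / P)"
      using assms pos by (simp add: powr_powr powr_divide)
    then show ?thesis
      by (simp add: powr_diff field_simps)
  qed
qed

section \<open>The \<open>p\<close>-norm on real vectors\<close>

lemma p_norm_nonneg: "0 \<le> p_norm p x"
proof (cases "p = \<infinity>")
  case True
  have "0 \<le> \<bar>x $ undefined\<bar>" by simp
  also have "\<dots> \<le> Max (range (\<lambda>i. \<bar>x $ i\<bar>))" by (rule Max_ge) auto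
  finally show ?thesis using True by (simp add: p_norm_def)
qed (simp add: p_norm_def)

lemma real_of_ereal_ge_1:
  assumes "1 \<le> p" "p \<noteq> \<infinity>"
  shows "1 \<le> real_of_ereal p"
  using assms by (cases p) auto

lemma p_norm_mono:
  fixes x y :: "real ^ 'n"
  assumes "1 \<le> p" "\<And>i. \<bar>x $ i\<bar> \<le> \<bar>y $ i\<bar>"
  shows "p_norm p x \<le> p_norm p y"
proof (cases "p = \<infinity>")
  case True
  have "\<bar>x $ i\<bar> \<le> Max (range (\<lambda>i. \<bar>y $ i\<bar>))" for i
    by (rule order_trans[OF assms(2)[of i]]) (rule Max_ge; auto)
  then show ?thesis using True by (auto simp: p_norm_def)
next
  case False
  note P = real_of_ereal_ge_1[OF assms(1) False]
  have "(\<Sum>i\<in>UNIV. \<bar>x $ i\<bar> powr real_of_ereal p) powr (1 / real_of_ereal p)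
     \<le> (\<Sum>i\<in>UNIV. \<bar>y $ i\<bar> powr real_of_ereal p) powr (1 / real_of_ereal p)"
    using P assms(2) by (intro powr_mono2 sum_mono sum_nonneg) auto
  then show ?thesis using False by (simp add: p_norm_def)
qed

lemma p_norm_scaleR:
  fixes x :: "real ^ 'n"
  assumes "1 \<le> p" "0 \<le> c"
  shows "p_norm p (c *\<^sub>R x) = c * p_norm p x"
proof (cases "p = \<infinity>")
  case True
  have "Max (range (\<lambda>i. \<bar>(c *\<^sub>R x) $ i\<bar>)) = Max ((\<lambda>t. c * t) ` range (\<lambda>i. \<bar>x $ i\<bar>))"
    using assms(2) by (simp add: image_image abs_mult)
  also have "\<dots> = c * Max (range (\<lambda>i. \<bar>x $ i\<bar>))"
    using assms(2) by (intro mono_Max_commute [symmetric]) (auto simp: mono_def mult_left_mono)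
  finally show ?thesis using True by (simp add: p_norm_def)
next
  case False
  note P = real_of_ereal_ge_1[OF assms(1) False]
  then show ?thesis using False assms(2)
    by (simp add: p_norm_def abs_mult powr_mult sum_distrib_left [symmetric] powr_powr sum_nonneg)
qed

text \<open>Hoelder's inequality for two coordinates, \<open>2 powr (1 - 1 / p)\<close> being the \<open>q\<close>-norm of
  \<open>(1, 1)\<close>.\<close>

lemma p_norm_two_coords:
  fixes x :: "real ^ 'n"
  assumes "1 \<le> p" "i \<noteq> j"
  shows "\<bar>x $ i\<bar> + \<bar>x $ j\<bar> \<le> 2 powr real_of_ereal (1 - 1 / p) * p_norm p x"
proof (cases "p = \<infinity>")
  case True
  \<comment> \<open>For \<open>p = \<infinity>\<close> the quotient \<open>1 / p\<close> is 0 and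
    the constant is 2, one for each coordinate.\<close>
  have "\<bar>x $ i\<bar> \<le> Max (range (\<lambda>i. \<bar>x $ i\<bar>))" for i
    by (rule Max_ge) auto
  from add_mono[OF this[of i] this[of j]] show ?thesis using True by (simp add: p_norm_def)
next
  case False
  define P where "P = real_of_ereal p"
  have P: "1 \<le> P" using real_of_ereal_ge_1[OF assms(1) False] by (simp add: P_def)
  have e: "real_of_ereal (1 - 1 / p) = 1 - 1 / P"
    using False assms(1) by (cases p) (auto simp: P_def one_ereal_def)
  have "\<bar>x $ i\<bar> + \<bar>x $ j\<bar>
      \<le> 2 powr (1 - 1 / P) * (\<bar>x $ i\<bar> powr P + \<bar>x $ j\<bar> powr P) powr (1 / P)"
    by (rule powr_sum_bound[OF P]) auto
  also have "\<dots> \<le> 2 powr (1 - 1 / P) * (\<Sum>i\<in>UNIV. \<bar>x $ i\<bar> powr P) powr (1 / P)"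
  proof (intro mult_left_mono powr_mono2)
    show "\<bar>x $ i\<bar> powr P + \<bar>x $ j\<bar> powr P \<le> (\<Sum>i\<in>UNIV. \<bar>x $ i\<bar> powr P)"
      using sum_mono2[of UNIV "{i, j}" "\<lambda>i. \<bar>x $ i\<bar> powr P"] assms(2) by simp
  qed (use P in auto)
  finally show ?thesis using False by (simp add: p_norm_def e P_def)
qed

text \<open>Lets \<open>b\<close> be expressed through \<open>p\<close> alone. The exponents are
  extended reals, so the rearrangement goes by cases on finite and infinite values.\<close>

lemma conjugate_exponent:
  fixes p q :: ereal
  assumes "1 \<le> p" "1 \<le> q" "1 / p + 1 / q = 1"
  shows "1 / q = 1 - 1 / p"
  using assms
  by (cases p; cases q)
    (auto simp: one_ereal_def zero_ereal_def divide_simps algebra_simps split: if_splits)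

section \<open>Limits with respect to an absolute value\<close>

lemma absolute_value_zero: "absolute_value av \<Longrightarrow> av 0 = 0"
  by (simp add: absolute_value_def)

lemma absolute_value_sub_commute:
  assumes "absolute_value av"
  shows "av (a - c) = av (c - a)"
  using absolute_value_minus[OF assms, of "a - c"] by simp

lemma absolute_value_triangle:
  assumes "absolute_value av"
  shows "av (a - c) \<le> av (a - e) + av (e - c)"
proof -
  have "av ((a - e) + (e - c)) \<le> av (a - e) + av (e - c)"
    using assms unfolding absolute_value_def by blast
  then show ?thesis by simp
qed

text \<open>The absolute value is a parameter and the field type carries no topology, so convergence
  is reduced to a real null sequence.\<close>

definition av_lim :: "('a::field \<Rightarrow> real) \<Rightarrow> (nat \<Rightarrow> 'a) \<Rightarrow> 'a \<Rightarrow> bool" where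
  "av_lim av u a \<longleftrightarrow> (\<lambda>k. av (u k - a)) \<longlonglongrightarrow> 0"

lemma av_lim_const: "absolute_value av \<Longrightarrow> av_lim av (\<lambda>k. a) a"
  by (simp add: av_lim_def absolute_value_zero)

lemma av_lim_unique:
  assumes "absolute_value av" "av_lim av u a" "av_lim av u c"
  shows "a = c"
proof -
  have "av (a - c) \<le> av (u k - a) + av (u k - c)" for k
    using absolute_value_triangle[OF assms(1), of a c "u k"]
      absolute_value_sub_commute[OF assms(1), of a "u k"] by simp
  moreover have "(\<lambda>k. av (u k - a) + av (u k - c)) \<longlonglongrightarrow> 0 + 0"
    using assms(2,3) unfolding av_lim_def by (intro tendsto_add)
  ultimately have "av (a - c) \<le> 0"
    by (auto dest: LIMSEQ_le_const)
  then show ?thesis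
    using assms(1) unfolding absolute_value_def by (metis eq_iff_diff_eq_0 order_antisym)
qed

lemma av_lim_add:
  assumes "absolute_value av" "av_lim av u a" "av_lim av v c"
  shows "av_lim av (\<lambda>k. u k + v k) (a + c)"
  unfolding av_lim_def
proof (rule Lim_null_comparison)
  have "av ((u k - a) + (v k - c)) \<le> av (u k - a) + av (v k - c)" for k
    using assms(1) unfolding absolute_value_def by blast
  then show "\<forall>\<^sub>F k in sequentially. norm (av (u k + v k - (a + c))) \<le> av (u k - a) + av (v k - c)"
    using assms(1) by (simp add: absolute_value_def algebra_simps)
  show "(\<lambda>k. av (u k - a) + av (v k - c)) \<longlonglongrightarrow> 0"
    using tendsto_add[OF assms(2,3)[unfolded av_lim_def]] by simp
qed

lemma av_lim_mult:
  assumes "absolute_value av" "av_lim av u a" "av_lim av v c"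
  shows "av_lim av (\<lambda>k. u k * v k) (a * c)"
  unfolding av_lim_def
proof (rule Lim_null_comparison)
  have tri: "av (s + t) \<le> av s + av t" and mult: "av (s * t) = av s * av t" for s t
    using assms(1) unfolding absolute_value_def by blast+
  have "av (u k * v k - a * c)
      \<le> av (u k - a) * av (v k - c) + av (u k - a) * av c + av a * av (v k - c)" for k
  proof -
    \<comment> \<open>Expanding around \<open>(a, c)\<close> avoids a separate proof that one of the
      sequences is bounded.\<close>
    have "u k * v k - a * c = (u k - a) * (v k - c) + (u k - a) * c + a * (v k - c)"
      by (simp add: algebra_simps)
    then show ?thesis
      using tri[of "(u k - a) * (v k - c) + (u k - a) * c" "a * (v k - c)"]
        tri[of "(u k - a) * (v k - c)" "(u k - a) * c"] by (simp add: mult)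
  qed
  then show "\<forall>\<^sub>F k in sequentially. norm (av (u k * v k - a * c))
      \<le> av (u k - a) * av (v k - c) + av (u k - a) * av c + av a * av (v k - c)"
    using assms(1) by (simp add: absolute_value_def)
  have "(\<lambda>k. av (u k - a) * av (v k - c) + av (u k - a) * av c + av a * av (v k - c))
      \<longlonglongrightarrow> 0 * 0 + 0 * av c + av a * 0"
    using assms(2,3) unfolding av_lim_def by (intro tendsto_intros)
  then show "(\<lambda>k. av (u k - a) * av (v k - c) + av (u k - a) * av c + av a * av (v k - c))
      \<longlonglongrightarrow> 0" by simp
qed

lemma av_lim_sum:
  assumes "absolute_value av" "\<And>i. i \<in> A \<Longrightarrow> av_lim av (\<lambda>k. u k i) (a i)"
  shows "av_lim av (\<lambda>k. \<Sum>i\<in>A. u k i) (\<Sum>i\<in>A. a i)"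
  using assms(2)
  by (induction A rule: infinite_finite_induct)
    (auto intro: av_lim_add[OF assms(1)] av_lim_const[OF assms(1)])

text \<open>Each coefficient of a product is a finite sum of products of coefficients of the
  factors. The induction therefore needs all coefficients at once, hence
  \<open>arbitrary: l\<close>.\<close>

lemma av_lim_coeff_prod:
  assumes "absolute_value av" "\<And>i l. i \<in> A \<Longrightarrow> av_lim av (\<lambda>k. coeff (P k i) l) (coeff (Q i) l)"
  shows "av_lim av (\<lambda>k. coeff (\<Prod>i\<in>A. P k i) l) (coeff (\<Prod>i\<in>A. Q i) l)"
  using assms(2)
proof (induction A arbitrary: l rule: infinite_finite_induct)
  case (insert i A)
  then show ?case
    by (auto simp: coeff_mult intro!: av_lim_sum[OF assms(1)] av_lim_mult[OF assms(1)])
qed (auto intro: av_lim_const[OF assms(1)])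

lemma av_lim_coeff_linear:
  assumes "absolute_value av" "av_lim av u a"
  shows "av_lim av (\<lambda>k. coeff [:- u k, 1:] l) (coeff [:- a, 1:] l)"
proof (cases l)
  case 0
  then show ?thesis
    using assms(2) absolute_value_sub_commute[OF assms(1)] by (simp add: av_lim_def)
qed (simp add: av_lim_const[OF assms(1)])

section \<open>Weierstrass corrections and root vectors\<close>

text \<open>Lagrange interpolation of \<open>f\<close> at the components of \<open>x\<close>.\<close>

lemma weierstrass_interpolation:
  fixes f :: "'a::field poly" and x :: "'a ^ 'n"
  assumes "degree f = CARD('n)" "x \<in> distinct_vecs"
  shows "f = smult (lead_coeff f) ((\<Prod>i\<in>UNIV. [:- (x $ i), 1:]) +
    (\<Sum>i\<in>UNIV. smult (weierstrass f x $ i) (\<Prod>j\<in>UNIV - {i}. [:- (x $ j), 1:])))"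
    (is "f = ?g")
proof (rule poly_eqI_degree_lead_coeff)
  let ?P = "\<Prod>i\<in>UNIV. [:- (x $ i), 1:]"
  let ?Q = "\<lambda>i. \<Prod>j\<in>UNIV - {i}. [:- (x $ j), 1:]"
  have f0: "f \<noteq> 0" using assms(1) by auto
  have inj: "inj (($) x)"
    using assms(2) unfolding inj_def distinct_vecs_def by auto
  have dP: "degree ?P = CARD('n)" by (simp add: degree_prod_sum_eq)
  have cP: "coeff ?P CARD('n) = 1"
    using lead_coeff_prod[of "\<lambda>i. [:- (x $ i), 1:]" UNIV] by (simp add: dP)
  have dQ: "degree (?Q i) = CARD('n) - 1" for i by (simp add: degree_prod_sum_eq)
  have n0: "0 < CARD('n)" by simp
  have cQ: "coeff (?Q i) CARD('n) = 0" for i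
    by (rule coeff_eq_0) (use dQ[of i] n0 in linarith)
  \<comment> \<open>Since both sides have degree at most n and the same coefficient at n, agreement
    at the n components of \<open>x\<close> suffices. The products \<open>?Q i\<close> have degree n
    - 1 and leave this coefficient alone.\<close>
  show "coeff f CARD('n) = coeff ?g CARD('n)"
    by (simp add: coeff_sum cQ cP assms(1))
  show "degree f \<le> CARD('n)" using assms(1) by simp
  have "degree (\<Sum>i\<in>UNIV. smult (weierstrass f x $ i) (?Q i)) \<le> CARD('n)"
    by (rule degree_sum_le) (auto intro!: order_trans[OF degree_smult_le] simp: dQ)
  then have "degree (?P + (\<Sum>i\<in>UNIV. smult (weierstrass f x $ i) (?Q i))) \<le> CARD('n)"
    by (rule degree_add_le[rotated]) (simp add: dP)
  then show "degree ?g \<le> CARD('n)"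
    by (rule order_trans[OF degree_smult_le])
  show "CARD('n) \<le> card (range (($) x))"
    using inj by (simp add: card_image)
  fix z assume "z \<in> range (($) x)"
  then obtain i where z: "z = x $ i" by auto
  have nz: "(\<Prod>j\<in>UNIV - {i}. x $ i - x $ j) \<noteq> 0"
    using assms(2) unfolding distinct_vecs_def by auto
  have P0: "poly ?P z = 0" using z by (auto simp: poly_prod)
  have Q0: "poly (?Q j) z = 0" if "j \<noteq> i" for j using z that by (auto simp: poly_prod)
  have Qi: "poly (?Q i) z = (\<Prod>j\<in>UNIV - {i}. x $ i - x $ j)"
    using z by (simp add: poly_prod)
  have "(\<Sum>j\<in>UNIV. weierstrass f x $ j * poly (?Q j) z) = weierstrass f x $ i * poly (?Q i) z"
    by (subst sum.remove[of _ i]) (auto simp: Q0)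
  then have "poly ?g z = lead_coeff f * (weierstrass f x $ i * (\<Prod>j\<in>UNIV - {i}. x $ i - x $ j))"
    by (simp add: poly_sum P0 Qi)
  also have "\<dots> = poly f z"
    using nz f0 z by (simp add: weierstrass_def)
  finally show "poly f z = poly ?g z" by simp
qed

lemma root_vector_limit:
  fixes f :: "'a::field poly" and x :: "nat \<Rightarrow> 'a ^ 'n"
  assumes av: "absolute_value av" and deg: "degree f = CARD('n)"
    and dist: "\<And>k. x k \<in> distinct_vecs"
    and lim: "\<And>i. av_lim av (\<lambda>k. x k $ i) (\<xi> $ i)"
    and W: "\<And>i. av_lim av (\<lambda>k. weierstrass f (x k) $ i) 0"
  shows "root_vector f \<xi>"
  unfolding root_vector_def
proof (rule poly_eqI)
  fix l
  \<comment> \<open>The summands \<open>0 * ...\<close> are kept so that the limit mirrors the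
    sequence term by term and the limit rules apply directly.\<close>
  have "av_lim av (\<lambda>k. lead_coeff f * (coeff (\<Prod>i\<in>UNIV. [:- (x k $ i), 1:]) l +
      (\<Sum>i\<in>UNIV. weierstrass f (x k) $ i * coeff (\<Prod>j\<in>UNIV - {i}. [:- (x k $ j), 1:]) l)))
    (lead_coeff f * (coeff (\<Prod>i\<in>UNIV. [:- (\<xi> $ i), 1:]) l +
      (\<Sum>i\<in>UNIV. 0 * coeff (\<Prod>j\<in>UNIV - {i}. [:- (\<xi> $ j), 1:]) l)))"
    by (intro av_lim_mult[OF av] av_lim_add[OF av] av_lim_sum[OF av] av_lim_const[OF av]
        av_lim_coeff_prod[OF av] av_lim_coeff_linear[OF av] lim W)
  \<comment> \<open>By interpolation at \<open>x k\<close> the sequence is in fact constant in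
    \<open>k\<close>.\<close>
  also have "(\<lambda>k. lead_coeff f * (coeff (\<Prod>i\<in>UNIV. [:- (x k $ i), 1:]) l +
      (\<Sum>i\<in>UNIV. weierstrass f (x k) $ i * coeff (\<Prod>j\<in>UNIV - {i}. [:- (x k $ j), 1:]) l)))
    = (\<lambda>k. coeff f l)"
  proof
    fix k
    show "lead_coeff f * (coeff (\<Prod>i\<in>UNIV. [:- (x k $ i), 1:]) l +
      (\<Sum>i\<in>UNIV. weierstrass f (x k) $ i * coeff (\<Prod>j\<in>UNIV - {i}. [:- (x k $ j), 1:]) l))
      = coeff f l"
      using arg_cong[OF weierstrass_interpolation[OF deg dist[of k]], of "\<lambda>g. coeff g l"]
      by (simp add: coeff_sum)
  qed
  finally have "coeff f l = lead_coeff f * (coeff (\<Prod>i\<in>UNIV. [:- (\<xi> $ i), 1:]) l +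
      (\<Sum>i\<in>UNIV. 0 * coeff (\<Prod>j\<in>UNIV - {i}. [:- (\<xi> $ j), 1:]) l))"
    by (rule av_lim_unique[OF av av_lim_const[OF av]])
  then show "coeff f l = coeff (smult (lead_coeff f) (\<Prod>i\<in>UNIV. [:- (\<xi> $ i), 1:])) l"
    by simp
qed

lemma poly_root_vector:
  fixes \<xi> :: "'a::field ^ 'n"
  assumes "root_vector f \<xi>" "f \<noteq> 0"
  shows "poly f z = 0 \<longleftrightarrow> z \<in> range (($) \<xi>)"
proof -
  have "poly f z = lead_coeff f * (\<Prod>i\<in>UNIV. z - \<xi> $ i)"
    by (subst assms(1)[unfolded root_vector_def]) (simp add: poly_prod)
  then show ?thesis using assms(2) by auto
qed

text \<open>Splitting off the linear factor at \<open>\<xi> $ i\<close> leaves a cofactor that does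
  not vanish there, because the components are distinct.\<close>

lemma order_root_vector:
  fixes \<xi> :: "'a::field ^ 'n"
  assumes "root_vector f \<xi>" "f \<noteq> 0" "\<xi> \<in> distinct_vecs"
  shows "order (\<xi> $ i) f = 1"
proof -
  let ?Q = "smult (lead_coeff f) (\<Prod>j\<in>UNIV - {i}. [:- (\<xi> $ j), 1:])"
  have eq: "f = [:- (\<xi> $ i), 1:] * ?Q"
    using assms(1) unfolding root_vector_def by (subst (asm) prod.remove[of _ i]) auto
  have "poly ?Q (\<xi> $ i) \<noteq> 0"
    using assms(2,3) unfolding distinct_vecs_def by (auto simp: poly_prod)
  then have "order (\<xi> $ i) ?Q = 0" by (rule order_0I)
  moreover have "order (\<xi> $ i) [:- (\<xi> $ i), 1:] = 1"
    using order_power_n_n[of "\<xi> $ i" 1] by simp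
  moreover have "[:- (\<xi> $ i), 1:] * ?Q \<noteq> 0" using eq assms(2) by metis
  ultimately show ?thesis using eq order_mult by (metis add.right_neutral)
qed

section \<open>Geometric steps, completeness and the order of convergence\<close>

lemma complete_geometric_limit:
  fixes u :: "nat \<Rightarrow> 'a::field"
  assumes "complete_normed_field av" "0 \<le> c" "c < 1"
    and step: "\<And>k. av (u k - u (Suc k)) \<le> M * c ^ k"
  obtains a where "av_lim av u a" "\<And>k. av (u k - a) \<le> M * c ^ k / (1 - c)"
    "\<And>k. av (u k - u 0) \<le> M / (1 - c)"
proof -
  have av: "absolute_value av" and complete: "Metric_space.mcomplete UNIV (\<lambda>a b. av (a - b))"
    using assms(1) unfolding complete_normed_field_def by auto
  interpret Metric_space UNIV "\<lambda>a b. av (a - b)"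
    by (rule absolute_value_Metric_space[OF av])
  have M: "0 \<le> M" using order_trans[OF nonneg step[of 0]] by simp
  have part: "av (u k - u (k + l)) \<le> (\<Sum>j<l. M * c ^ (k + j))" for k l
  proof (induction l)
    case (Suc l)
    have "av (u k - u (k + Suc l)) \<le> av (u k - u (k + l)) + av (u (k + l) - u (Suc (k + l)))"
      using absolute_value_triangle[OF av] by simp
    then show ?case using Suc step[of "k + l"] by simp
  qed (simp add: absolute_value_zero[OF av])
  \<comment> \<open>A tail bound uniform in \<open>l\<close>: it gives the Cauchy property, and it
    survives the passage to the limit in \<open>l\<close>.\<close>
  have bound: "av (u k - u (k + l)) \<le> M * c ^ k / (1 - c)" for k l
  proof -
    have "(\<Sum>j<l. M * c ^ (k + j)) = M * c ^ k * (\<Sum>j<l. c ^ j)"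
      by (simp add: sum_distrib_left power_add mult.assoc)
    also have "(\<Sum>j<l. c ^ j) \<le> 1 / (1 - c)"
      using assms(2,3) by (subst sum_gp_strict) (auto simp: divide_simps)
    finally have "(\<Sum>j<l. M * c ^ (k + j)) \<le> M * c ^ k * (1 / (1 - c))"
      using M assms(2) by (auto simp: mult_left_mono)
    with part[of k l] show ?thesis by simp
  qed
  have small: "(\<lambda>k. M * c ^ k / (1 - c)) \<longlonglongrightarrow> 0"
    using assms(2,3) by (auto intro!: tendsto_eq_intros LIMSEQ_power_zero)
  have "MCauchy u"
    unfolding MCauchy_def
  proof (intro conjI allI impI)
    fix e :: real assume "0 < e"
    then obtain N where N: "\<And>k. k \<ge> N \<Longrightarrow> M * c ^ k / (1 - c) < e"
      using order_tendstoD(2)[OF small] by (auto simp: eventually_sequentially)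
    have "av (u k - u k') < e" if "N \<le> k" "k \<le> k'" for k k'
      using bound[of k "k' - k"] N[of k] that by simp
    then show "\<exists>N. \<forall>n n'. N \<le> n \<longrightarrow> N \<le> n' \<longrightarrow> av (u n - u n') < e"
      by (metis nle_le commute)
  qed auto
  then obtain a where "limitin mtopology u a sequentially"
    using complete unfolding mcomplete_def by blast
  then have ev: "\<forall>\<^sub>F k in sequentially. av (u k - a) < e" if "0 < e" for e
    using that by (simp add: limitin_metric)
  have lim: "av_lim av u a"
    unfolding av_lim_def
    by (rule order_tendstoI) (use ev in \<open>auto intro: always_eventually less_le_trans[OF _ nonneg]\<close>)
  show thesis
  proof (rule that[OF lim])
    fix k
    \<comment> \<open>Let \<open>l\<close> tend to infinity in the triangle inequality through
      \<open>u (k + l)\<close>.\<close>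
    have "(\<lambda>l. M * c ^ k / (1 - c) + av (u (l + k) - a)) \<longlonglongrightarrow> M * c ^ k / (1 - c) + 0"
      by (intro tendsto_intros LIMSEQ_ignore_initial_segment lim[unfolded av_lim_def])
    moreover have "av (u k - a) \<le> M * c ^ k / (1 - c) + av (u (l + k) - a)" for l
      using absolute_value_triangle[OF av, of "u k" a "u (k + l)"] bound[of k l]
      by (simp add: add.commute)
    ultimately show "av (u k - a) \<le> M * c ^ k / (1 - c)"
      by (auto dest: LIMSEQ_le_const)
    \<comment> \<open>This bound will keep the iterates in the closed ball around the start.\<close>
    show "av (u k - u 0) \<le> M / (1 - c)"
      using bound[of 0 k] commute[of "u k" "u 0"] by simp
  qed
qed

text \<open>For \<open>r > 1\<close> one has \<open>geom_sum k r = (r ^ k - 1) / (r - 1)\<close>, so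
  a power with this exponent is \<open>\<eta> powr (r ^ k) / \<eta>\<close> for a suitable
  \<open>\<eta>\<close>; for \<open>r = 1\<close> the exponent is just \<open>k\<close>.\<close>

lemma convergence_of_order_geom_sum:
  fixes x :: "nat \<Rightarrow> 'a::field ^ 'n"
  assumes "0 \<le> lam" "lam < 1" "1 \<le> r" "\<And>i. 0 \<le> M i"
    and bound: "\<And>k i. av (x k $ i - \<xi> $ i) \<le> M i * rpow lam (geom_sum k r)"
    and nonneg: "\<And>a. 0 \<le> av a"
  shows "convergence_of_order av r x \<xi>"
proof -
  \<comment> \<open>The maximum replaces a possible \<open>lam = 0\<close> by a positive base, so
    that \<open>rpow\<close> agrees with \<open>powr\<close> and \<open>\<eta>\<close> is
    positive.\<close>
  define \<mu> where "\<mu> = max lam (1 / 2)"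
  have \<mu>: "0 < \<mu>" "\<mu> < 1" "lam \<le> \<mu>" using assms(2) by (auto simp: \<mu>_def)
  \<comment> \<open>The summand 1 keeps \<open>C\<close> positive when all \<open>M i\<close>
    vanish.\<close>
  define C where "C = (\<Sum>i\<in>UNIV. M i) + 1"
  have C: "0 < C" using assms(4) by (simp add: C_def add_nonneg_pos sum_nonneg)
  have S: "0 \<le> geom_sum k r" for k using assms(3) by (simp add: geom_sum_nonneg)
  have *: "p_norm \<infinity> (cone_norm av (x k - \<xi>)) \<le> C * \<mu> powr geom_sum k r" for k
  proof -
    have "av (x k $ i - \<xi> $ i) \<le> C * \<mu> powr geom_sum k r" for i
    proof -
      have "M i \<le> C"
        using member_le_sum[of i UNIV M] assms(4) by (simp add: C_def)
      then have "M i * rpow lam (geom_sum k r) \<le> C * rpow \<mu> (geom_sum k r)"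
        using assms(1) \<mu>(3) S C by (intro mult_mono rpow_mono_base rpow_ge_0) auto
      with bound[of k i] show ?thesis using \<mu>(1) by (simp add: rpow_def)
    qed
    then show ?thesis by (auto simp: p_norm_def cone_norm_def nonneg)
  qed
  show ?thesis
  proof (cases "r = 1")
    case True
    then have "p_norm \<infinity> (cone_norm av (x k - \<xi>)) \<le> C * \<mu> ^ k" for k
      using *[of k] \<mu> by (simp add: geom_sum_def powr_realpow)
    then show ?thesis
      unfolding convergence_of_order_def using True C \<mu> by force
  next
    case False
    then have r: "1 < r" using assms(3) by simp
    define \<eta> where "\<eta> = \<mu> powr (1 / (r - 1))"
    have \<eta>: "0 < \<eta>" "\<eta> < 1"
      using \<mu> r powr_less_mono2[of "1 / (r - 1)" \<mu> 1] by (auto simp: \<eta>_def)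
    have "\<mu> powr geom_sum k r = \<eta> powr (r ^ k) / \<eta>" for k
    proof -
      have "geom_sum k r = (r ^ k - 1) / (r - 1)"
        using geom_sum_times[of r k] r by (simp add: eq_divide_eq mult.commute)
      then have "geom_sum k r = 1 / (r - 1) * r ^ k - 1 / (r - 1)"
        by (simp add: diff_divide_distrib)
      then show ?thesis using \<mu> by (simp add: \<eta>_def powr_powr powr_diff)
    qed
    then have "p_norm \<infinity> (cone_norm av (x k - \<xi>)) \<le> C / \<eta> * \<eta> powr (r ^ k)" for k
      using *[of k] by simp
    moreover have "0 < C / \<eta>" using C \<eta> by simp
    ultimately show ?thesis
      unfolding convergence_of_order_def using r \<eta> by (metis greaterThanLessThan_iff less_irrefl)
  qed
qed

section \<open>Iterations controlled by the Weierstrass correction\<close>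

text \<open>The order on cone norms is coordinatewise, so the hypotheses on \<open>T\<close> are
  taken componentwise. The constant \<open>b\<close> is written in terms of
  \<open>p\<close>.\<close>

locale weierstrass_iteration =
  fixes av :: "'a::field \<Rightarrow> real"
    and f :: "'a poly"
    and T :: "'a ^ 'n \<Rightarrow> 'a ^ 'n"
    and p :: ereal
    and b \<tau> m :: real
    and \<beta> \<gamma> :: "real \<Rightarrow> real"
  assumes complete: "complete_normed_field av"
    and degree: "degree f = CARD('n)"
    and card: "CARD('n) \<ge> 2"
    and p: "1 \<le> p"
    and b: "b = 2 powr real_of_ereal (1 - 1 / p)"
    and step_le: "\<And>y i. y \<in> distinct_vecs \<Longrightarrow> Ef av p f y < \<tau> \<Longrightarrow>
      av (y $ i - T y $ i) \<le> \<gamma> (Ef av p f y) * av (weierstrass f y $ i)"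
    and weierstrass_step_le: "\<And>y i. y \<in> distinct_vecs \<Longrightarrow> Ef av p f y < \<tau> \<Longrightarrow>
      av (weierstrass f (T y) $ i) \<le> \<beta> (Ef av p f y) * av (weierstrass f y $ i)"
    and m: "0 \<le> m"
    and beta: "quasi_homogeneous_on {0..<\<tau>} m \<beta>"
    and gamma_mono: "mono_on {0..<\<tau>} \<gamma>"
    and gamma_pos: "\<And>t. t \<in> {0..<\<tau>} \<Longrightarrow> \<gamma> t > 0"
    and psi_pos': "\<And>t. t \<in> {0..<\<tau>} \<Longrightarrow> 1 - b * t * \<gamma> t > 0"
begin

abbreviation E :: "'a ^ 'n \<Rightarrow> real" where "E \<equiv> Ef av p f"
abbreviation W :: "'a ^ 'n \<Rightarrow> 'a ^ 'n" where "W \<equiv> weierstrass f"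
abbreviation d :: "'a ^ 'n \<Rightarrow> real ^ 'n" where "d \<equiv> sep_vec av"
abbreviation \<psi> :: "real \<Rightarrow> real" where "\<psi> \<equiv> \<lambda>t. 1 - b * t * \<gamma> t"
abbreviation \<phi> :: "real \<Rightarrow> real" where "\<phi> \<equiv> \<lambda>t. \<beta> t / \<psi> t"

text \<open>The conditions on a starting vector. All iterates inherit them
  (\<open>admissible_iterate\<close>), which permits restarting the analysis at any iterate.\<close>

definition admissible :: "'a ^ 'n \<Rightarrow> bool" where
  "admissible y \<longleftrightarrow> y \<in> distinct_vecs \<and> E y < \<tau> \<and> \<phi> (E y) \<le> 1"

section \<open>Monotonicity and bounds for the control functions\<close>

lemma av: "absolute_value av"
  using complete unfolding complete_normed_field_def by simp

lemma av_nonneg [simp]: "0 \<le> av a"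
  and av_eq_0 [simp]: "av a = 0 \<longleftrightarrow> a = 0"
  using av unfolding absolute_value_def by auto

lemma av_zero [simp]: "av 0 = 0"
  by (rule absolute_value_zero[OF av])

lemma av_le_0 [simp]: "av a \<le> 0 \<longleftrightarrow> a = 0"
  by (metis av_eq_0 av_nonneg order_antisym order_refl)

lemma b_pos: "0 < b"
  by (simp add: b)

lemma E_nonneg: "0 \<le> E y"
  by (simp add: Ef_def p_norm_nonneg)

lemma beta_nonneg: "0 \<le> t \<Longrightarrow> t < \<tau> \<Longrightarrow> 0 \<le> \<beta> t"
  using beta unfolding quasi_homogeneous_on_def by auto

lemma beta_mono: "0 \<le> s \<Longrightarrow> s \<le> t \<Longrightarrow> t < \<tau> \<Longrightarrow> \<beta> s \<le> \<beta> t"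
  using quasi_homogeneous_on_mono[OF beta m] .

lemma gamma_le: "0 \<le> s \<Longrightarrow> s \<le> t \<Longrightarrow> t < \<tau> \<Longrightarrow> \<gamma> s \<le> \<gamma> t"
  using gamma_mono by (auto intro: mono_onD)

lemma gamma_pos_E: "E y < \<tau> \<Longrightarrow> 0 < \<gamma> (E y)"
  using gamma_pos[of "E y"] E_nonneg[of y] by simp

lemma psi_pos: "0 \<le> t \<Longrightarrow> t < \<tau> \<Longrightarrow> 0 < \<psi> t"
  using psi_pos'[of t] by simp

lemma psi_antimono:
  assumes "0 \<le> s" "s \<le> t" "t < \<tau>"
  shows "\<psi> t \<le> \<psi> s"
proof -
  have "b * s * \<gamma> s \<le> b * t * \<gamma> t"
    using assms b_pos gamma_pos[of s] gamma_le[of s t] by (intro mult_mono) auto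
  then show ?thesis by simp
qed

lemma psi_le_1:
  assumes "0 \<le> t" "t < \<tau>"
  shows "\<psi> t \<le> 1"
  using assms b_pos gamma_pos[of t] by simp

text \<open>At \<open>t = 0\<close> the value is exactly 1. This is why \<open>E y = 0\<close> needs
  separate treatment wherever \<open>1 - \<beta> (E y)\<close> is a denominator.\<close>

lemma psi_less_1:
  assumes "0 < t" "t < \<tau>"
  shows "\<psi> t < 1"
  using assms b_pos gamma_pos[of t] by simp

lemma phi_nonneg: "0 \<le> t \<Longrightarrow> t < \<tau> \<Longrightarrow> 0 \<le> \<phi> t"
  using beta_nonneg[of t] psi_pos[of t] by simp

lemma phi_mono:
  assumes "0 \<le> s" "s \<le> t" "t < \<tau>"
  shows "\<phi> s \<le> \<phi> t"
  using assms beta_mono[of s t] beta_nonneg[of t] psi_antimono[of s t] psi_pos[of t] psi_pos[of s]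
  by (intro frac_le) auto

lemma psi_times_phi: "0 \<le> t \<Longrightarrow> t < \<tau> \<Longrightarrow> \<psi> t * \<phi> t = \<beta> t"
  using psi_pos[of t] by simp

text \<open>Quasi-homogeneity with scaling factor \<open>\<phi> t\<close> to the power
  \<open>geom_sum k (m + 1)\<close>. Raising the factor to the power \<open>m\<close> and using
  \<open>\<beta> t = \<psi> t * \<phi> t\<close> gives the exponent
  \<open>m * geom_sum k (m + 1) + 1\<close>, which equals \<open>(m + 1) ^ k\<close>.\<close>

lemma beta_scaled_le:
  assumes t: "0 \<le> t" "t < \<tau>" "\<phi> t \<le> 1"
    and u: "0 \<le> u" "u \<le> t * rpow (\<phi> t) (geom_sum k (m + 1))"
  shows "\<beta> u \<le> \<psi> t * rpow (\<phi> t) ((m + 1) ^ k)"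
proof -
  let ?s = "rpow (\<phi> t) (geom_sum k (m + 1))"
  have S: "0 \<le> geom_sum k (m + 1)" using m by (simp add: geom_sum_nonneg)
  have \<phi>: "0 \<le> \<phi> t" using t by (intro phi_nonneg)
  have s: "0 \<le> ?s" "?s \<le> 1" using rpow_ge_0 rpow_le_1[OF \<phi> t(3) S] by auto
  have "?s * t < \<tau>" using s t mult_right_mono[of ?s 1 t] by linarith
  then have "\<beta> u \<le> \<beta> (?s * t)" using u by (intro beta_mono) (auto simp: mult.commute)
  also have "\<dots> \<le> rpow ?s m * \<beta> t"
    using beta s t unfolding quasi_homogeneous_on_def by auto
  also have "\<dots> = \<psi> t * (rpow (\<phi> t) (geom_sum k (m + 1) * m) * rpow (\<phi> t) 1)"
    by (simp only: rpow_rpow[OF S m] rpow_one_right[OF \<phi>] mult.left_commute[of "\<psi> t"]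
        psi_times_phi[OF t(1,2)])
  also have "\<dots> = \<psi> t * rpow (\<phi> t) (geom_sum k (m + 1) * m + 1)"
    using S m by (subst rpow_add) auto
  also have "geom_sum k (m + 1) * m + 1 = (m + 1) ^ k"
    using geom_sum_times[of "m + 1" k] by (simp add: mult.commute)
  finally show ?thesis .
qed

section \<open>Separation of components and the one-step estimates\<close>

lemma other_index: "UNIV - {i :: 'n} \<noteq> {}"
proof
  assume "UNIV - {i} = {}"
  then have "CARD('n) \<le> card {i}" by (intro card_mono) auto
  with card show False by simp
qed

text \<open>Here n being at least 2 enters: the minimum is taken over a nonempty set of positive
  distances.\<close>

lemma sep_vec_pos: "y \<in> distinct_vecs \<Longrightarrow> 0 < d y $ i"
  using other_index[of i] by (auto simp: sep_vec_def distinct_vecs_def Min_gr_iff less_le[of 0 "av _"])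

lemma sep_vec_le: "i \<noteq> j \<Longrightarrow> d y $ i \<le> av (y $ i - y $ j)"
  unfolding sep_vec_def by (auto intro!: Min_le)

lemma sep_vec_geI:
  assumes "\<And>j. j \<noteq> i \<Longrightarrow> c \<le> av (y $ i - y $ j)"
  shows "c \<le> d y $ i"
  using assms other_index[of i] unfolding sep_vec_def by auto

lemma quot_add_le:
  assumes "y \<in> distinct_vecs" "i \<noteq> j"
  shows "av (W y $ i) / d y $ i + av (W y $ j) / d y $ j \<le> b * E y"
  using p_norm_two_coords[OF p assms(2), of "cone_quot av (W y) (d y)"]
    sep_vec_pos[OF assms(1), of i] sep_vec_pos[OF assms(1), of j]
  by (simp add: Ef_def b cone_quot_def)

text \<open>Both \<open>d y $ i\<close> and \<open>d y $ j\<close> are at most the distance of the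
  two components, so multiplying \<open>quot_add_le\<close> by that distance bounds the corrections
  themselves.\<close>

lemma correction_add_le:
  assumes "y \<in> distinct_vecs" "i \<noteq> j"
  shows "av (W y $ i) + av (W y $ j) \<le> b * E y * av (y $ i - y $ j)"
proof -
  let ?D = "av (y $ i - y $ j)"
  have d: "0 < d y $ i" "0 < d y $ j" "d y $ i \<le> ?D" "d y $ j \<le> ?D"
    using assms sep_vec_pos sep_vec_le[of i j y] sep_vec_le[of j i y]
      absolute_value_sub_commute[OF av, of "y $ i" "y $ j"] by auto
  have *: "w \<le> w / e * ?D" if "0 \<le> w" "0 < e" "e \<le> ?D" for w e
    using that mult_left_mono[of e ?D w] by (simp add: field_simps)
  have "av (W y $ i) + av (W y $ j) \<le> (av (W y $ i) / d y $ i + av (W y $ j) / d y $ j) * ?D"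
    unfolding distrib_right using d by (intro add_mono *) auto
  also have "\<dots> \<le> b * E y * ?D"
    by (intro mult_right_mono quot_add_le assms) auto
  finally show ?thesis .
qed

text \<open>Pairing \<open>i\<close> with any other index in \<open>correction_add_le\<close> gives
  a vanishing right-hand side. This settles the degenerate case of later estimates.\<close>

lemma correction_eq_0:
  assumes "y \<in> distinct_vecs" "E y = 0"
  shows "W y $ i = 0"
proof -
  obtain j where "j \<in> UNIV - {i}" using other_index[of i] by blast
  then have "i \<noteq> j" by auto
  from correction_add_le[OF assms(1) this] assms(2)
  have "av (W y $ i) + av (W y $ j) \<le> 0" by simp
  then have "av (W y $ i) \<le> 0"
    using av_nonneg[of "W y $ j"] by linarith
  then show ?thesis by simp
qed

lemma step_separation:
  assumes "y \<in> distinct_vecs" "E y < \<tau>" "i \<noteq> j"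
  shows "\<psi> (E y) * av (y $ i - y $ j) \<le> av (T y $ i - T y $ j)"
proof -
  have "av (y $ i - y $ j) \<le> av (y $ i - T y $ i) + av (T y $ i - T y $ j) + av (y $ j - T y $ j)"
    using absolute_value_triangle[OF av, of "y $ i" "y $ j" "T y $ i"]
      absolute_value_triangle[OF av, of "T y $ i" "y $ j" "T y $ j"]
      absolute_value_sub_commute[OF av, of "y $ j" "T y $ j"] by linarith
  moreover have "av (y $ i - T y $ i) + av (y $ j - T y $ j)
      \<le> \<gamma> (E y) * (av (W y $ i) + av (W y $ j))"
    unfolding distrib_left by (intro add_mono step_le assms)
  moreover have "\<dots> \<le> \<gamma> (E y) * (b * E y * av (y $ i - y $ j))"
    using gamma_pos_E[OF assms(2)] correction_add_le[OF assms(1,3)] by (intro mult_left_mono) auto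
  ultimately show ?thesis by (simp add: algebra_simps)
qed

lemma step_distinct:
  assumes "y \<in> distinct_vecs" "E y < \<tau>"
  shows "T y \<in> distinct_vecs"
  unfolding distinct_vecs_def
proof clarify
  fix i j :: 'n assume "i \<noteq> j" and eq: "T y $ i = T y $ j"
  then have "\<psi> (E y) * av (y $ i - y $ j) \<le> 0"
    using step_separation[OF assms, of i j] by simp
  moreover have "0 < av (y $ i - y $ j)"
    using assms(1) \<open>i \<noteq> j\<close> by (simp add: distinct_vecs_def less_le)
  ultimately show False
    using psi_pos[OF E_nonneg assms(2)] by (simp add: mult_le_0_iff)
qed

text \<open>In each quotient the numerator gains at most the factor \<open>\<beta> (E y)\<close> and
  the denominator keeps at least the factor \<open>\<psi> (E y)\<close>. Monotonicity and
  homogeneity carry this over to the \<open>p\<close>-norm.\<close>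

lemma E_step:
  assumes "y \<in> distinct_vecs" "E y < \<tau>"
  shows "E (T y) \<le> \<phi> (E y) * E y"
proof -
  have \<psi>: "0 < \<psi> (E y)" by (rule psi_pos[OF E_nonneg assms(2)])
  have \<phi>: "0 \<le> \<phi> (E y)" by (rule phi_nonneg[OF E_nonneg assms(2)])
  have "p_norm p (cone_quot av (W (T y)) (d (T y)))
      \<le> p_norm p (\<phi> (E y) *\<^sub>R cone_quot av (W y) (d y))"
  proof (rule p_norm_mono[OF p])
    fix i
    have d: "0 < d y $ i" "0 < d (T y) $ i"
      using sep_vec_pos assms step_distinct by auto
    have "\<psi> (E y) * d y $ i \<le> d (T y) $ i"
    proof (rule sep_vec_geI)
      fix j assume "j \<noteq> i"
      then show "\<psi> (E y) * d y $ i \<le> av (T y $ i - T y $ j)"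
        using step_separation[OF assms, of i j] sep_vec_le[of i j y] \<psi>
        by (smt (verit) mult_left_mono)
    qed
    then have "av (W (T y) $ i) / d (T y) $ i
        \<le> \<beta> (E y) * av (W y $ i) / (\<psi> (E y) * d y $ i)"
      using d \<psi> beta_nonneg[OF E_nonneg assms(2)] weierstrass_step_le[OF assms]
      by (intro frac_le) auto
    also have "\<dots> = \<phi> (E y) * (av (W y $ i) / d y $ i)" by simp
    finally have "av (W (T y) $ i) / d (T y) $ i \<le> \<phi> (E y) * (av (W y $ i) / d y $ i)" .
    moreover have "0 \<le> av (W (T y) $ i) / d (T y) $ i" "0 \<le> \<phi> (E y) * (av (W y $ i) / d y $ i)"
      using d by (simp, intro mult_nonneg_nonneg[OF \<phi>]) simp
    ultimately show "\<bar>cone_quot av (W (T y)) (d (T y)) $ i\<bar>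
        \<le> \<bar>(\<phi> (E y) *\<^sub>R cone_quot av (W y) (d y)) $ i\<bar>"
      by (simp only: cone_quot_def vector_scaleR_component vec_lambda_beta real_scaleR_def
          abs_of_nonneg)
  qed
  also have "\<dots> = \<phi> (E y) * p_norm p (cone_quot av (W y) (d y))"
    by (rule p_norm_scaleR[OF p \<phi>])
  finally show ?thesis by (simp only: Ef_def)
qed

section \<open>Decay of \<open>E\<close> and of the corrections along the iteration\<close>

lemma iterates:
  assumes "admissible y"
  shows "(T ^^ k) y \<in> distinct_vecs \<and>
    E ((T ^^ k) y) \<le> E y * rpow (\<phi> (E y)) (geom_sum k (m + 1))"
\<comment> \<open>Distinctness is carried along because \<open>E_step\<close> requires it. The
  exponents add up since \<open>geom_sum k r + r ^ k = geom_sum (Suc k) r\<close>.\<close>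
proof (induction k)
  case 0
  then show ?case using assms by (simp add: admissible_def geom_sum_def)
next
  case (Suc k)
  let ?z = "(T ^^ k) y"
  let ?l = "\<phi> (E y)"
  let ?S = "geom_sum k (m + 1)"
  have y: "0 \<le> E y" "E y < \<tau>" "?l \<le> 1"
    using assms E_nonneg by (auto simp: admissible_def)
  have l: "0 \<le> ?l" by (rule phi_nonneg[OF y(1,2)])
  have S: "0 \<le> ?S" using m by (simp add: geom_sum_nonneg)
  have zy: "E ?z \<le> E y"
    using Suc mult_left_mono[OF rpow_le_1[OF l y(3) S] y(1)] by simp
  then have z: "?z \<in> distinct_vecs" "E ?z < \<tau>" using Suc y by auto
  \<comment> \<open>The numerator is bounded by \<open>beta_scaled_le\<close> and the induction
    hypothesis, the denominator from below by antitonicity of \<open>\<psi>\<close>.\<close>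
  have "\<phi> (E ?z) \<le> (\<psi> (E y) * rpow ?l ((m + 1) ^ k)) / \<psi> (E y)"
    using Suc y zy z beta_scaled_le[OF y, of "E ?z" k] psi_pos[OF y(1,2)]
      psi_antimono[of "E ?z" "E y"] E_nonneg[of ?z] beta_nonneg[of "E ?z"]
    by (intro frac_le) auto
  also have "\<dots> = rpow ?l ((m + 1) ^ k)" using psi_pos[OF y(1,2)] by simp
  finally have "\<phi> (E ?z) * E ?z \<le> rpow ?l ((m + 1) ^ k) * (E y * rpow ?l ?S)"
    using Suc E_nonneg rpow_ge_0 by (intro mult_mono) auto
  also have "\<dots> = E y * rpow ?l (geom_sum (Suc k) (m + 1))"
    using S m by (simp add: geom_sum_Suc rpow_add)
  finally show ?case
    using E_step[OF z] step_distinct[OF z] by simp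
qed

lemma E_iterate_le:
  assumes "admissible y"
  shows "E ((T ^^ k) y) \<le> E y"
proof -
  have y: "0 \<le> E y" "E y < \<tau>" "\<phi> (E y) \<le> 1"
    using assms E_nonneg by (auto simp: admissible_def)
  have "rpow (\<phi> (E y)) (geom_sum k (m + 1)) \<le> 1"
    using y m by (intro rpow_le_1 phi_nonneg geom_sum_nonneg) auto
  from mult_left_mono[OF this y(1)] show ?thesis using iterates[OF assms, of k] by simp
qed

lemma admissible_iterate:
  assumes "admissible y"
  shows "admissible ((T ^^ k) y)"
  using assms iterates[OF assms, of k] E_iterate_le[OF assms, of k]
    phi_mono[OF E_nonneg E_iterate_le[OF assms, of k]]
  by (auto simp: admissible_def)

lemma beta_iterate_le:
  assumes "admissible y"
  shows "\<beta> (E ((T ^^ k) y)) \<le> \<psi> (E y) * rpow (\<phi> (E y)) ((m + 1) ^ k)"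
  using assms iterates[OF assms, of k] E_nonneg
  by (intro beta_scaled_le) (auto simp: admissible_def)

lemma beta_less_1:
  assumes "admissible y" "0 < E y"
  shows "\<beta> (E y) < 1"
proof -
  have y: "E y < \<tau>" "\<phi> (E y) \<le> 1" using assms(1) by (auto simp: admissible_def)
  have "\<beta> (E y) \<le> \<psi> (E y)"
    using y psi_pos[OF E_nonneg y(1)] by (simp add: divide_le_eq)
  with psi_less_1[OF assms(2) y(1)] show ?thesis by simp
qed

lemma correction_Suc_le:
  assumes "admissible y"
  shows "av (W ((T ^^ Suc k) y) $ i)
    \<le> \<psi> (E y) * rpow (\<phi> (E y)) ((m + 1) ^ k) * av (W ((T ^^ k) y) $ i)"
proof -
  have "av (W (T ((T ^^ k) y)) $ i) \<le> \<beta> (E ((T ^^ k) y)) * av (W ((T ^^ k) y) $ i)"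
    using admissible_iterate[OF assms, of k] by (intro weierstrass_step_le) (auto simp: admissible_def)
  also have "\<dots> \<le> \<psi> (E y) * rpow (\<phi> (E y)) ((m + 1) ^ k) * av (W ((T ^^ k) y) $ i)"
    by (intro mult_right_mono beta_iterate_le assms) auto
  finally show ?thesis by simp
qed

lemma correction_le:
  assumes "admissible y"
  shows "av (W ((T ^^ k) y) $ i)
    \<le> \<psi> (E y) ^ k * rpow (\<phi> (E y)) (geom_sum k (m + 1)) * av (W y $ i)"
proof (induction k)
  case (Suc k)
  let ?l = "\<phi> (E y)"
  have \<psi>: "0 < \<psi> (E y)"
    using assms by (intro psi_pos E_nonneg) (auto simp: admissible_def)
  have "av (W ((T ^^ Suc k) y) $ i)
      \<le> \<psi> (E y) * rpow ?l ((m + 1) ^ k) *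
        (\<psi> (E y) ^ k * rpow ?l (geom_sum k (m + 1)) * av (W y $ i))"
    using \<psi> rpow_ge_0 by (intro order_trans[OF correction_Suc_le[OF assms]] mult_left_mono[OF Suc]) auto
  also have "\<dots> = \<psi> (E y) ^ Suc k * rpow ?l (geom_sum (Suc k) (m + 1)) * av (W y $ i)"
    using m by (simp add: geom_sum_Suc rpow_add geom_sum_nonneg)
  finally show ?case .
qed (simp add: geom_sum_def)

text \<open>Cruder than \<open>correction_le\<close>, but with a fixed ratio, as needed for summing
  the steps as a geometric series.\<close>

lemma correction_geometric:
  assumes "admissible y"
  shows "av (W ((T ^^ k) y) $ i) \<le> \<beta> (E y) ^ k * av (W y $ i)"
proof (induction k)
  case (Suc k)
  let ?z = "(T ^^ k) y"
  have z: "?z \<in> distinct_vecs" "E ?z < \<tau>" and y: "E y < \<tau>"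
    using admissible_iterate[OF assms, of k] assms by (auto simp: admissible_def)
  have "av (W (T ?z) $ i) \<le> \<beta> (E ?z) * av (W ?z $ i)"
    by (intro weierstrass_step_le z)
  also have "\<dots> \<le> \<beta> (E y) * (\<beta> (E y) ^ k * av (W y $ i))"
    using Suc beta_mono[OF E_nonneg E_iterate_le[OF assms] y, of k] beta_nonneg[OF E_nonneg y]
    by (intro mult_mono) auto
  finally show ?case by (simp add: mult.assoc)
qed simp

section \<open>Limits of the iteration and error bounds\<close>

text \<open>If \<open>E y = 0\<close> then \<open>W y = 0\<close>, so that any ratio may be used; \<open>\<beta> 0\<close> itself may be \<open>1\<close>.\<close>

lemma geometric_ratio:
  assumes "admissible y"
  obtains c where "0 \<le> c" "c < 1"
    "\<And>i. av (W y $ i) / (1 - c) = av (W y $ i) / (1 - \<beta> (E y))"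
    "\<And>k i. av (W ((T ^^ k) y) $ i) \<le> c ^ k * av (W y $ i)"
proof (cases "E y = 0")
  case True
  then have W0: "W y $ i = 0" for i
    using assms by (intro correction_eq_0) (auto simp: admissible_def)
  show thesis
  proof (rule that[of 0])
    fix k i
    show "av (W ((T ^^ k) y) $ i) \<le> 0 ^ k * av (W y $ i)"
      using correction_geometric[OF assms, of k i] by (simp add: W0)
  qed (simp_all add: W0)
next
  case False
  then have "0 < E y" using E_nonneg[of y] by simp
  then show thesis
    using that[of "\<beta> (E y)"] beta_less_1[OF assms] correction_geometric[OF assms]
      beta_nonneg[OF E_nonneg, of y] assms by (simp add: admissible_def)
qed

lemma iteration_limit:
  assumes "admissible y"
  obtains a where "av_lim av (\<lambda>k. (T ^^ k) y $ i) a"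
    "av (y $ i - a) \<le> \<gamma> (E y) / (1 - \<beta> (E y)) * av (W y $ i)"
    "\<And>k. av ((T ^^ k) y $ i - y $ i) \<le> \<gamma> (E y) / (1 - \<beta> (E y)) * av (W y $ i)"
proof -
  obtain c where c: "0 \<le> c" "c < 1"
    and eq: "\<And>i. av (W y $ i) / (1 - c) = av (W y $ i) / (1 - \<beta> (E y))"
    and le: "\<And>k i. av (W ((T ^^ k) y) $ i) \<le> c ^ k * av (W y $ i)"
    using geometric_ratio[OF assms] by metis
  have y: "E y < \<tau>" using assms by (simp add: admissible_def)
  have step: "av ((T ^^ k) y $ i - (T ^^ Suc k) y $ i) \<le> \<gamma> (E y) * av (W y $ i) * c ^ k" for k
  proof -
    let ?z = "(T ^^ k) y"
    have z: "?z \<in> distinct_vecs" "E ?z < \<tau>"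
      using admissible_iterate[OF assms, of k] by (auto simp: admissible_def)
    have "av (?z $ i - T ?z $ i) \<le> \<gamma> (E ?z) * av (W ?z $ i)"
      by (rule step_le[OF z])
    also have "\<dots> \<le> \<gamma> (E y) * (c ^ k * av (W y $ i))"
      using gamma_le[OF E_nonneg E_iterate_le[OF assms] y, of k] gamma_pos_E[OF y]
      by (intro mult_mono le) auto
    finally show ?thesis by (simp add: mult_ac)
  qed
  \<comment> \<open>The auxiliary ratio \<open>c\<close> is exchanged for
    \<open>\<beta> (E y)\<close>; when they differ, the correction is 0 and so are both
    sides.\<close>
  have eq': "\<gamma> (E y) * av (W y $ i) / (1 - c) = \<gamma> (E y) / (1 - \<beta> (E y)) * av (W y $ i)"
    using arg_cong[OF eq[of i], of "\<lambda>t. \<gamma> (E y) * t"] by simp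
  from complete_geometric_limit[OF complete c step] obtain a
    where a: "av_lim av (\<lambda>k. (T ^^ k) y $ i) a"
      and le1: "\<And>k. av ((T ^^ k) y $ i - a) \<le> \<gamma> (E y) * av (W y $ i) * c ^ k / (1 - c)"
      and le2: "\<And>k. av ((T ^^ k) y $ i - (T ^^ 0) y $ i) \<le> \<gamma> (E y) * av (W y $ i) / (1 - c)"
    by metis
  show thesis
    using that[OF a] le1[of 0] le2 eq' by simp
qed

lemma iteration_limit_vec:
  assumes "admissible y"
  obtains \<xi> where "\<And>i. av_lim av (\<lambda>k. (T ^^ k) y $ i) (\<xi> $ i)" "root_vector f \<xi>"
proof -
  have "\<exists>a. av_lim av (\<lambda>k. (T ^^ k) y $ i) a" for i
    by (rule iteration_limit[OF assms, of i]) blast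
  then obtain a where a: "\<And>i. av_lim av (\<lambda>k. (T ^^ k) y $ i) (a i)" by metis
  obtain c where c: "0 \<le> c" "c < 1"
    and le: "\<And>k i. av (W ((T ^^ k) y) $ i) \<le> c ^ k * av (W y $ i)"
    using geometric_ratio[OF assms] by metis
  have "av_lim av (\<lambda>k. W ((T ^^ k) y) $ i) 0" for i
    unfolding av_lim_def
  proof (rule Lim_null_comparison)
    show "\<forall>\<^sub>F k in sequentially. norm (av (W ((T ^^ k) y) $ i - 0)) \<le> c ^ k * av (W y $ i)"
      using le by simp
    show "(\<lambda>k. c ^ k * av (W y $ i)) \<longlonglongrightarrow> 0"
      using c by (auto intro!: tendsto_mult_left_zero LIMSEQ_power_zero)
  qed
  moreover have "(T ^^ k) y \<in> distinct_vecs" for k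
    using iterates[OF assms] by blast
  ultimately have "root_vector f (\<chi> i. a i)"
    using a by (intro root_vector_limit[OF av degree, of "\<lambda>k. (T ^^ k) y"]) auto
  then show thesis using that[of "\<chi> i. a i"] a by simp
qed

text \<open>The iteration restarted at the \<open>k\<close>-th iterate has the same limit, so the
  bound for a starting vector applies. If the denominator is 0, then \<open>E\<close> and the
  correction vanish at this iterate, so the value of the quotient is harmless.\<close>

lemma error_le:
  assumes "admissible y" "av_lim av (\<lambda>k. (T ^^ k) y $ i) a"
  shows "av ((T ^^ k) y $ i - a)
    \<le> \<gamma> (E ((T ^^ k) y)) / (1 - \<beta> (E ((T ^^ k) y))) * av (W ((T ^^ k) y) $ i)"
proof -
  obtain a' where a': "av_lim av (\<lambda>l. (T ^^ l) ((T ^^ k) y) $ i) a'"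
    "av ((T ^^ k) y $ i - a')
      \<le> \<gamma> (E ((T ^^ k) y)) / (1 - \<beta> (E ((T ^^ k) y))) * av (W ((T ^^ k) y) $ i)"
    using iteration_limit[OF admissible_iterate[OF assms(1), of k], of i] by metis
  have "av_lim av (\<lambda>l. (T ^^ l) ((T ^^ k) y) $ i) a"
    using LIMSEQ_ignore_initial_segment[OF assms(2)[unfolded av_lim_def], of k]
    by (simp add: av_lim_def funpow_add)
  from av_lim_unique[OF av this a'(1)] a'(2) show ?thesis by simp
qed

text \<open>Common frame for \<open>error_a_priori\<close>, \<open>error_Suc_le\<close> and the
  order of convergence: \<open>A\<close>, \<open>B\<close> and \<open>w\<close> are upper bounds to
  be chosen in each case. The condition on \<open>B\<close> is limited to \<open>0 < E y\<close>,
  since for \<open>E y = 0\<close> both sides are 0.\<close>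

lemma error_le_start:
  assumes "admissible y" "av_lim av (\<lambda>k. (T ^^ k) y $ i) a"
    and "\<gamma> (E ((T ^^ k) y)) \<le> A" "\<beta> (E ((T ^^ k) y)) \<le> B" "0 < E y \<Longrightarrow> B < 1"
    and "0 \<le> w" "av (W ((T ^^ k) y) $ i) \<le> w * av (W y $ i)"
  shows "av ((T ^^ k) y $ i - a) \<le> A * (w / (1 - B)) * av (W y $ i)"
proof (cases "E y = 0")
  case True
  then have W0: "W y $ i = 0"
    using assms(1) by (intro correction_eq_0) (auto simp: admissible_def)
  then have "W ((T ^^ k) y) $ i = 0" using assms(7) by simp
  then show ?thesis using error_le[OF assms(1,2), of k] W0 by simp
next
  case False
  then have B: "B < 1" using assms(5) E_nonneg[of y] by simp
  have "0 < \<gamma> (E ((T ^^ k) y))"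
    using admissible_iterate[OF assms(1), of k] by (intro gamma_pos_E) (simp add: admissible_def)
  then have "\<gamma> (E ((T ^^ k) y)) / (1 - \<beta> (E ((T ^^ k) y))) * av (W ((T ^^ k) y) $ i)
      \<le> A / (1 - B) * (w * av (W y $ i))"
    using assms(3,4,7) B by (intro mult_mono frac_le) auto
  with error_le[OF assms(1,2), of k] show ?thesis by simp
qed

lemma beta_bound_less_1:
  assumes "admissible y" "0 < E y" "0 \<le> e"
  shows "\<psi> (E y) * rpow (\<phi> (E y)) e < 1"
proof -
  have y: "E y < \<tau>" "\<phi> (E y) \<le> 1" using assms(1) by (auto simp: admissible_def)
  have "\<psi> (E y) * rpow (\<phi> (E y)) e \<le> \<psi> (E y) * 1"
    using psi_pos[OF E_nonneg y(1)] rpow_le_1[OF phi_nonneg[OF E_nonneg y(1)] y(2) assms(3)]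
    by (intro mult_left_mono) auto
  also have "\<dots> < 1" using psi_less_1[OF assms(2) y(1)] by simp
  finally show ?thesis .
qed

lemma error_a_priori:
  assumes "admissible y" "av_lim av (\<lambda>k. (T ^^ k) y $ i) a"
  shows "av ((T ^^ k) y $ i - a) \<le>
    \<gamma> (E y * rpow (\<phi> (E y)) (geom_sum k (m + 1))) *
      ((\<psi> (E y) ^ k * rpow (\<phi> (E y)) (geom_sum k (m + 1))) /
        (1 - \<psi> (E y) * rpow (\<phi> (E y)) ((m + 1) ^ k))) * av (W y $ i)"
proof (rule error_le_start[OF assms])
  let ?s = "rpow (\<phi> (E y)) (geom_sum k (m + 1))"
  have y: "0 \<le> E y" "E y < \<tau>" "\<phi> (E y) \<le> 1"
    using assms(1) E_nonneg by (auto simp: admissible_def)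
  have "?s \<le> 1"
    using y m by (intro rpow_le_1 phi_nonneg geom_sum_nonneg) auto
  then have "E y * ?s < \<tau>" using mult_left_mono[of ?s 1 "E y"] y by simp
  then show "\<gamma> (E ((T ^^ k) y)) \<le> \<gamma> (E y * ?s)"
    using iterates[OF assms(1), of k] by (intro gamma_le E_nonneg) auto
  show "0 \<le> \<psi> (E y) ^ k * ?s"
    using psi_pos[OF y(1,2)] rpow_ge_0[of "\<phi> (E y)"] by (intro mult_nonneg_nonneg zero_le_power) auto
qed (use beta_iterate_le[OF assms(1)] beta_bound_less_1[OF assms(1)] correction_le[OF assms(1)] m
  in auto)

text \<open>Stated for the first step only; with the \<open>k\<close>-th iterate as starting vector
  it yields the bound for every step.\<close>

lemma error_Suc_le:
  assumes "admissible y" "av_lim av (\<lambda>k. (T ^^ k) y $ i) a"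
  shows "av (T y $ i - a) \<le>
    \<psi> (E y) * \<phi> (E y) / (1 - \<psi> (E y) * rpow (\<phi> (E y)) (m + 1)) * \<gamma> (E (T y)) * av (W y $ i)"
proof -
  have y: "0 \<le> E y" "E y < \<tau>" "y \<in> distinct_vecs"
    using assms(1) E_nonneg by (auto simp: admissible_def)
  have w: "av (W (T y) $ i) \<le> \<psi> (E y) * \<phi> (E y) * av (W y $ i)"
    unfolding psi_times_phi[OF y(1,2)] by (rule weierstrass_step_le[OF y(3,2)])
  have nn: "0 \<le> \<psi> (E y) * \<phi> (E y)"
    unfolding psi_times_phi[OF y(1,2)] by (rule beta_nonneg[OF y(1,2)])
  have "av ((T ^^ 1) y $ i - a) \<le> \<gamma> (E (T y)) * (\<psi> (E y) * \<phi> (E y) /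
      (1 - \<psi> (E y) * rpow (\<phi> (E y)) (m + 1))) * av (W y $ i)"
    by (rule error_le_start[OF assms])
      (use beta_iterate_le[OF assms(1), of 1] beta_bound_less_1[OF assms(1), of "m + 1"] w nn m
        in \<open>simp_all del: times_divide_eq_right\<close>)
  then show ?thesis by (simp add: mult_ac)
qed

lemma convergence_of_order_iteration:
  assumes "admissible y" "\<phi> (E y) < 1" "\<And>i. av_lim av (\<lambda>k. (T ^^ k) y $ i) (\<xi> $ i)"
  shows "convergence_of_order av (m + 1) (\<lambda>k. (T ^^ k) y) \<xi>"
proof (rule convergence_of_order_geom_sum)
  have y: "0 \<le> E y" "E y < \<tau>"
    using assms(1) E_nonneg by (auto simp: admissible_def)
  have \<psi>: "0 < \<psi> (E y)" "\<psi> (E y) \<le> 1" using psi_pos psi_le_1 y by auto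
  \<comment> \<open>The strict inequality makes \<open>1 - \<beta> (E y)\<close> positive even when
    \<open>E y = 0\<close>, so it may enter the constant.\<close>
  have "\<beta> (E y) < \<psi> (E y)" using assms(2) \<psi> by (simp add: divide_less_eq)
  then have \<beta>: "\<beta> (E y) < 1" using \<psi> by simp
  show "0 \<le> \<phi> (E y)" by (rule phi_nonneg[OF y])
  show "0 \<le> \<gamma> (E y) * (1 / (1 - \<beta> (E y))) * av (W y $ i)" for i
    using \<beta> gamma_pos_E[OF y(2)] by simp
  fix k i
  let ?s = "rpow (\<phi> (E y)) (geom_sum k (m + 1))"
  have "\<psi> (E y) ^ k * ?s \<le> 1 * ?s"
    using \<psi> rpow_ge_0 by (intro mult_right_mono power_le_one) auto
  from mult_right_mono[OF this, of "av (W y $ i)"]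
  have "av (W ((T ^^ k) y) $ i) \<le> ?s * av (W y $ i)"
    using correction_le[OF assms(1), of k i] by simp
  then have "av ((T ^^ k) y $ i - \<xi> $ i) \<le> \<gamma> (E y) * (?s / (1 - \<beta> (E y))) * av (W y $ i)"
    using gamma_le[OF E_nonneg E_iterate_le[OF assms(1)] y(2)]
      beta_mono[OF E_nonneg E_iterate_le[OF assms(1)] y(2)] \<beta> rpow_ge_0
    by (intro error_le_start assms)
  then show "av ((T ^^ k) y $ i - \<xi> $ i) \<le> \<gamma> (E y) * (1 / (1 - \<beta> (E y))) * av (W y $ i) * ?s"
    by (simp add: mult_ac)
qed (use assms(2) m in auto)

section \<open>Disjoint disks and simple zeros\<close>

lemma disks_disjoint:
  assumes "admissible y" "\<phi> (E y) < 1"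
  shows "disjoint_family
    (\<lambda>i. closed_disk av (y $ i) (\<gamma> (E y) / (1 - \<beta> (E y)) * av (W y $ i)))"
  unfolding disjoint_family_on_def
proof clarify
  fix i j :: 'n
  assume ij: "i \<noteq> j"
  have y: "0 \<le> E y" "E y < \<tau>" "y \<in> distinct_vecs"
    using assms(1) E_nonneg by (auto simp: admissible_def)
  have \<beta>: "\<beta> (E y) < \<psi> (E y)" using assms(2) psi_pos[OF y(1,2)] by (simp add: divide_less_eq)
  then have \<beta>1: "\<beta> (E y) < 1" using psi_le_1[OF y(1,2)] by linarith
  have D: "0 < av (y $ i - y $ j)"
    using y(3) ij by (simp add: distinct_vecs_def less_le)
  have "\<gamma> (E y) * (av (W y $ i) + av (W y $ j)) \<le> \<gamma> (E y) * (b * E y * av (y $ i - y $ j))"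
    using gamma_pos_E[OF y(2)] correction_add_le[OF y(3) ij] by (intro mult_left_mono) auto
  also have "\<dots> = (b * E y * \<gamma> (E y)) * av (y $ i - y $ j)" by (simp add: mult_ac)
  \<comment> \<open>Strictness of \<open>\<phi> (E y) < 1\<close> enters here, as
    \<open>b * E y * \<gamma> (E y)\<close> equals \<open>1 - \<psi> (E y)\<close>.\<close>
  also have "\<dots> < (1 - \<beta> (E y)) * av (y $ i - y $ j)"
    using \<beta> D by (intro mult_strict_right_mono) auto
  finally have sep: "\<gamma> (E y) / (1 - \<beta> (E y)) * av (W y $ i) +
      \<gamma> (E y) / (1 - \<beta> (E y)) * av (W y $ j) < av (y $ i - y $ j)"
    using \<beta>1 by (simp add: distrib_left pos_divide_less_eq mult.commute flip: add_divide_distrib)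
  show "closed_disk av (y $ i) (\<gamma> (E y) / (1 - \<beta> (E y)) * av (W y $ i)) \<inter>
      closed_disk av (y $ j) (\<gamma> (E y) / (1 - \<beta> (E y)) * av (W y $ j)) = {}"
  proof (rule ccontr)
    assume "\<not> ?thesis"
    then obtain z where "av (z - y $ i) \<le> \<gamma> (E y) / (1 - \<beta> (E y)) * av (W y $ i)"
      "av (z - y $ j) \<le> \<gamma> (E y) / (1 - \<beta> (E y)) * av (W y $ j)"
      unfolding closed_disk_def by blast
    then show False
      using sep absolute_value_triangle[OF av, of "y $ i" "y $ j" z]
        absolute_value_sub_commute[OF av, of "y $ i" z] by linarith
  qed
qed

lemma limit_in_disk:
  assumes "admissible y" "\<And>i. av_lim av (\<lambda>k. (T ^^ k) y $ i) (\<xi> $ i)"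
  shows "\<xi> $ i \<in> closed_disk av ((T ^^ k) y $ i)
    (\<gamma> (E ((T ^^ k) y)) / (1 - \<beta> (E ((T ^^ k) y))) * av (W ((T ^^ k) y) $ i))"
  unfolding closed_disk_def mem_Collect_eq absolute_value_sub_commute[OF av, of "\<xi> $ i"]
  by (rule error_le[OF assms])

text \<open>Each component of the limit lies in its own starting disk, and these disks are
  disjoint.\<close>

lemma limit_distinct:
  assumes "admissible y" "\<phi> (E y) < 1" "\<And>i. av_lim av (\<lambda>k. (T ^^ k) y $ i) (\<xi> $ i)"
  shows "\<xi> \<in> distinct_vecs"
  unfolding distinct_vecs_def
proof clarify
  fix i j assume "i \<noteq> j" "\<xi> $ i = \<xi> $ j"
  then show False
    using disjoint_family_onD[OF disks_disjoint[OF assms(1,2)], of i j]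
      limit_in_disk[OF assms(1,3), of i 0] limit_in_disk[OF assms(1,3), of j 0] by auto
qed

lemma phi_iterate_less_1:
  assumes "admissible y" "\<phi> (E y) < 1"
  shows "\<phi> (E ((T ^^ k) y)) < 1"
  using phi_mono[OF E_nonneg E_iterate_le[OF assms(1), of k]] assms by (simp add: admissible_def)

text \<open>Every zero is some \<open>\<xi> $ j\<close> and lies in the \<open>j\<close>-th disk;
  disjointness then forces \<open>j = i\<close>.\<close>

lemma unique_zero_in_disk:
  assumes "admissible y" "\<phi> (E y) < 1" "\<And>i. av_lim av (\<lambda>k. (T ^^ k) y $ i) (\<xi> $ i)"
    "root_vector f \<xi>"
  shows "\<exists>!z. z \<in> closed_disk av ((T ^^ k) y $ i)
    (\<gamma> (E ((T ^^ k) y)) / (1 - \<beta> (E ((T ^^ k) y))) * av (W ((T ^^ k) y) $ i)) \<and> poly f z = 0"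
proof (rule ex1I[of _ "\<xi> $ i"])
  have f0: "f \<noteq> 0" using degree by auto
  note zeros = poly_root_vector[OF assms(4) f0]
  note disk = limit_in_disk[OF assms(1,3)]
  show "\<xi> $ i \<in> closed_disk av ((T ^^ k) y $ i)
    (\<gamma> (E ((T ^^ k) y)) / (1 - \<beta> (E ((T ^^ k) y))) * av (W ((T ^^ k) y) $ i)) \<and> poly f (\<xi> $ i) = 0"
    using disk zeros by blast
  fix z
  assume z: "z \<in> closed_disk av ((T ^^ k) y $ i)
    (\<gamma> (E ((T ^^ k) y)) / (1 - \<beta> (E ((T ^^ k) y))) * av (W ((T ^^ k) y) $ i)) \<and> poly f z = 0"
  then obtain j where j: "z = \<xi> $ j" using zeros by blast
  have "i = j"
  proof (rule ccontr)
    assume "i \<noteq> j"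
    then show False
      using disjoint_family_onD[OF disks_disjoint[OF admissible_iterate[OF assms(1)]
            phi_iterate_less_1[OF assms(1,2)]], of i j k] z j disk[of j k] by blast
  qed
  with j show "z = \<xi> $ i" by simp
qed

lemma card_simple_zeros:
  assumes "admissible y" "\<phi> (E y) < 1" "\<And>i. av_lim av (\<lambda>k. (T ^^ k) y $ i) (\<xi> $ i)"
    "root_vector f \<xi>"
  shows "card {z. poly f z = 0 \<and> order z f = 1} = CARD('n)"
proof -
  have f0: "f \<noteq> 0" using degree by auto
  note dist = limit_distinct[OF assms(1-3)]
  have "{z. poly f z = 0 \<and> order z f = 1} = range (($) \<xi>)"
    using poly_root_vector[OF assms(4) f0] order_root_vector[OF assms(4) f0 dist] by auto
  moreover have "inj (($) \<xi>)"
    using dist unfolding inj_def distinct_vecs_def by auto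
  ultimately show ?thesis by (simp add: card_image)
qed

end

section \<open>From components back to cone norms\<close>

lemma cone_norm_le_scaleR_iff:
  "cone_norm av u \<le> c *\<^sub>R cone_norm av v \<longleftrightarrow> (\<forall>i. av (u $ i) \<le> c * av (v $ i))"
  by (simp add: cone_norm_def less_eq_vec_def)

lemma cone_converges_componentwise:
  assumes "\<And>i. av_lim av (\<lambda>k. x k $ i) (\<xi> $ i)"
  shows "cone_converges av x \<xi>"
  unfolding cone_converges_def
  using assms by (auto intro!: vec_tendstoI simp: av_lim_def cone_norm_def)

theorem theorem2p2:
  fixes av :: "'a::field \<Rightarrow> real"
    and f :: "'a poly"
    and D :: "('a ^ 'n) set"
    and T :: "'a ^ 'n \<Rightarrow> 'a ^ 'n"
    and p q :: ereal
    and b \<tau> m r lam \<theta> :: real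
    and \<beta> \<gamma> \<psi> \<phi> :: "real \<Rightarrow> real"
    and x0 :: "'a ^ 'n"
    and x :: "nat \<Rightarrow> 'a ^ 'n"
    and E :: "'a ^ 'n \<Rightarrow> real"
    and W :: "'a ^ 'n \<Rightarrow> 'a ^ 'n"
  assumes field: "complete_normed_field av"
    and deg: "degree f = CARD('n)" "CARD('n) \<ge> 2"
    and pq: "1 \<le> p" "1 \<le> q" "1 / p + 1 / q = 1"
    and b: "b = 2 powr real_of_ereal (1 / q)"
    and E: "E = Ef av p f"
    and W: "W = weierstrass f"
    and tau: "\<tau> > 0"
    and hyp_a: "\<And>y. y \<in> distinct_vecs \<Longrightarrow> E y < \<tau> \<Longrightarrow> y \<in> D"
    and hyp_b: "\<And>y. y \<in> distinct_vecs \<Longrightarrow> E y < \<tau> \<Longrightarrow>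
       cone_norm av (y - T y) \<le> \<gamma> (E y) *\<^sub>R cone_norm av (W y)"
    and hyp_c: "\<And>y. y \<in> distinct_vecs \<Longrightarrow> E y < \<tau> \<Longrightarrow>
       cone_norm av (W (T y)) \<le> \<beta> (E y) *\<^sub>R cone_norm av (W y)"
    and beta: "m \<ge> 0" "quasi_homogeneous_on {0..<\<tau>} m \<beta>"
    and gamma: "mono_on {0..<\<tau>} \<gamma>" "\<And>t. t \<in> {0..<\<tau>} \<Longrightarrow> \<gamma> t > 0"
    and psi: "\<psi> = (\<lambda>t. 1 - b * t * \<gamma> t)" "\<And>t. t \<in> {0..<\<tau>} \<Longrightarrow> \<psi> t > 0"
    and phi: "\<phi> = (\<lambda>t. \<beta> t / \<psi> t)"
    and r: "r = m + 1"
    and x0: "x0 \<in> distinct_vecs" "E x0 < \<tau>" "\<phi> (E x0) \<le> 1"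
    and x: "x = (\<lambda>k. (T ^^ k) x0)"
    and lambda: "lam = \<phi> (E x0)"
    and theta: "\<theta> = \<psi> (E x0)"
  shows
    "(\<forall>k. x k \<in> D \<and> x k \<in> distinct_vecs \<and> E (x k) < \<tau>) \<and>
     (\<forall>k. x k \<in> closed_cone_ball av x0
              ((\<gamma> (E x0) / (1 - \<beta> (E x0))) *\<^sub>R cone_norm av (W x0))) \<and>
     (\<exists>\<xi>. root_vector f \<xi> \<and> cone_converges av x \<xi> \<and>
        (\<phi> (E x0) < 1 \<longrightarrow> convergence_of_order av r x \<xi>) \<and>
        (\<forall>k. cone_norm av (x k - \<xi>) \<le>
           (\<gamma> (E x0 * rpow lam (geom_sum k r)) *
              ((\<theta> ^ k * rpow lam (geom_sum k r)) / (1 - \<theta> * rpow lam (r ^ k))))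
           *\<^sub>R cone_norm av (W x0)) \<and>
        (\<forall>k. cone_norm av (x k - \<xi>) \<le>
           (\<gamma> (E (x k)) / (1 - \<beta> (E (x k)))) *\<^sub>R cone_norm av (W (x k))) \<and>
        (\<forall>k. let lamk = \<phi> (E (x k)); \<theta>k = \<psi> (E (x k)) in
           cone_norm av (x (Suc k) - \<xi>) \<le>
             ((\<theta>k * lamk) / (1 - \<theta>k * rpow lamk r) * \<gamma> (E (x (Suc k))))
             *\<^sub>R cone_norm av (W (x k)))) \<and>
     (\<forall>k. cone_norm av (W (x (Suc k))) \<le>
            (\<theta> * rpow lam (r ^ k)) *\<^sub>R cone_norm av (W (x k)) \<and>
          cone_norm av (W (x k)) \<le>
            (\<theta> ^ k * rpow lam (geom_sum k r)) *\<^sub>R cone_norm av (W x0)) \<and>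
     (\<phi> (E x0) < 1 \<longrightarrow>
        card {z. poly f z = 0 \<and> order z f = 1} = CARD('n) \<and>
        (\<forall>k. let disk = (\<lambda>i. closed_disk av (x k $ i)
                     (\<gamma> (E (x k)) / (1 - \<beta> (E (x k))) * av (W (x k) $ i))) in
           disjoint_family disk \<and> (\<forall>i. \<exists>!z. z \<in> disk i \<and> poly f z = 0)))"
proof -
  interpret weierstrass_iteration av f T p b \<tau> m \<beta> \<gamma>
  proof
    show "b = 2 powr real_of_ereal (1 - 1 / p)"
      using b conjugate_exponent[OF pq] by simp
    show "av (y $ i - T y $ i) \<le> \<gamma> (Ef av p f y) * av (weierstrass f y $ i)"
      "av (weierstrass f (T y) $ i) \<le> \<beta> (Ef av p f y) * av (weierstrass f y $ i)"
      if "y \<in> distinct_vecs" "Ef av p f y < \<tau>" for y i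
      using hyp_b[of y] hyp_c[of y] that by (auto simp: E W cone_norm_le_scaleR_iff)
    show "0 < 1 - b * t * \<gamma> t" if "t \<in> {0..<\<tau>}" for t
      using psi that by simp
  qed (use field deg pq beta gamma in auto)
  have adm: "admissible x0"
    using x0 by (simp add: admissible_def E phi psi(1))
  obtain \<xi> where lim: "\<And>i. av_lim av (\<lambda>k. (T ^^ k) x0 $ i) (\<xi> $ i)" and root: "root_vector f \<xi>"
    using iteration_limit_vec[OF adm] by metis
  have adm_k: "admissible (x k)" for k
    unfolding x by (rule admissible_iterate[OF adm])
  \<comment> \<open>A shifted sequence keeps its limit, so \<open>error_Suc_le\<close> can be
    applied from \<open>x k\<close>.\<close>
  have lim_k: "av_lim av (\<lambda>l. (T ^^ l) (x k) $ i) (\<xi> $ i)" for k i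
    using LIMSEQ_ignore_initial_segment[OF lim[of i, unfolded av_lim_def], of k]
    by (simp add: x av_lim_def funpow_add)
  \<comment> \<open>\<open>T\<close> is a total function here, so well-definedness of the iteration
    means that every iterate lies in \<open>D\<close>.\<close>
  have 1: "x k \<in> D \<and> x k \<in> distinct_vecs \<and> E (x k) < \<tau>" for k
    using adm_k[of k] hyp_a[of "x k"] by (simp add: admissible_def E)
  have 2: "x k \<in> closed_cone_ball av x0
      ((\<gamma> (E x0) / (1 - \<beta> (E x0))) *\<^sub>R cone_norm av (W x0))" for k
    unfolding closed_cone_ball_def mem_Collect_eq cone_norm_le_scaleR_iff x E W
      vector_minus_component
  proof
    fix i
    show "av ((T ^^ k) x0 $ i - x0 $ i)
      \<le> \<gamma> (Ef av p f x0) / (1 - \<beta> (Ef av p f x0)) * av (weierstrass f x0 $ i)"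
      by (rule iteration_limit[OF adm, of i]) blast
  qed
  have conv: "convergence_of_order av r x \<xi>" if "\<phi> (E x0) < 1"
    using convergence_of_order_iteration[OF adm _ lim] that by (simp add: x E r phi psi(1))
  have 3: "cone_norm av (x k - \<xi>) \<le>
      (\<gamma> (E x0 * rpow lam (geom_sum k r)) *
        ((\<theta> ^ k * rpow lam (geom_sum k r)) / (1 - \<theta> * rpow lam (r ^ k))))
      *\<^sub>R cone_norm av (W x0)" for k
    unfolding cone_norm_le_scaleR_iff lambda theta phi psi(1) r x E W vector_minus_component
    using error_a_priori[OF adm lim] by blast
  have 4: "cone_norm av (x k - \<xi>) \<le>
      (\<gamma> (E (x k)) / (1 - \<beta> (E (x k)))) *\<^sub>R cone_norm av (W (x k))" for k
    unfolding cone_norm_le_scaleR_iff x E W vector_minus_component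
    using error_le[OF adm lim] by blast
  have 5: "let lamk = \<phi> (E (x k)); \<theta>k = \<psi> (E (x k)) in
      cone_norm av (x (Suc k) - \<xi>) \<le>
        ((\<theta>k * lamk) / (1 - \<theta>k * rpow lamk r) * \<gamma> (E (x (Suc k))))
        *\<^sub>R cone_norm av (W (x k))" for k
    unfolding cone_norm_le_scaleR_iff Let_def phi psi(1) r E W vector_minus_component
    using error_Suc_le[OF adm_k lim_k, of k] by (simp add: x)
  have 6: "cone_norm av (W (x (Suc k))) \<le> (\<theta> * rpow lam (r ^ k)) *\<^sub>R cone_norm av (W (x k))" for k
    unfolding cone_norm_le_scaleR_iff lambda theta phi psi(1) r x E W
    using correction_Suc_le[OF adm] by blast
  have 7: "cone_norm av (W (x k)) \<le> (\<theta> ^ k * rpow lam (geom_sum k r)) *\<^sub>R cone_norm av (W x0)" for k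
    unfolding cone_norm_le_scaleR_iff lambda theta phi psi(1) r x E W
    using correction_le[OF adm] by blast
  have 8: "card {z. poly f z = 0 \<and> order z f = 1} = CARD('n)" if "\<phi> (E x0) < 1"
    using card_simple_zeros[OF adm _ lim root] that by (simp add: E phi psi(1))
  have 9: "let disk = (\<lambda>i. closed_disk av (x k $ i)
        (\<gamma> (E (x k)) / (1 - \<beta> (E (x k))) * av (W (x k) $ i))) in
      disjoint_family disk \<and> (\<forall>i. \<exists>!z. z \<in> disk i \<and> poly f z = 0)"
    if "\<phi> (E x0) < 1" for k
  proof -
    have lt: "\<beta> (Ef av p f x0) / (1 - b * Ef av p f x0 * \<gamma> (Ef av p f x0)) < 1"
      using that by (simp add: E phi psi(1))
    show ?thesis
      unfolding Let_def x E W
      using disks_disjoint[OF admissible_iterate[OF adm] phi_iterate_less_1[OF adm lt]]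
        unique_zero_in_disk[OF adm lt lim root] by blast
  qed
  show ?thesis
    using 1 2 3 4 5 6 7 8 9 conv root cone_converges_componentwise[OF lim, folded x] by blast
qed

end
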